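(* Let $D$ and $E$ be two oriented knot diagrams and let $D\#E$ denote their connected sum. Then $$\mathrm{SCI}(D\#E)=\mathrm{SCI}(D)+\mathrm{SCI}(E).$$
   Context: Knot diagrams are oriented diagrams in $\mathbb{R}^2$. For a diagram with underlying oriented curve $C$, the index of a region (component of $\mathbb{R}^2\setminus C$) is the winding number of $C$ around any of its points, and the index $\mathrm{ind}(c)$ of a crossing $c$ is the average of the indices of the four regions adjacent to $c$ (with multiplicity). $\mathrm{SCI}(D)=\sum_{c}\mathrm{sgn}(c)\,\mathrm{ind}(c)$, summing over all crossings of $D$, where $\mathrm{sgn}(c)$ is the sign of the crossing. Connected sum of diagrams: $D$ and $E$ are placed in disjoint half-planes, and an edge of $D$ adjacent to its unbounded region is joined to an edge of $E$ adjacent to its unbounded region by a band lying in the common unbounded region and disjoint from the diagrams otherwise, compatibly with the orientations (no new crossings are created); each such diagram is a connected sum $D\#E$. *)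

theory Defs
  imports "HOL-Complex_Analysis.Complex_Analysis"
begin

text \<open>
  The plane is \<^typ>\<open>complex\<close>. An oriented knot diagram is a closed curve, given as a map on the real
  line of period 1, together with the set of those parameters at which the curve passes over
  another strand.
\<close>

record diagram =
  curve :: "real \<Rightarrow> complex"
  over :: "real set"

text \<open>
  Piecewise C1 immersions, so that smooth and polygonal diagrams are both covered. One-sided limits
  of the derivative exist and are nonzero everywhere; hence the curve is C1 with nonzero derivative
  except at corners, and corners are isolated.
\<close>

definition piecewise_immersion :: "(real \<Rightarrow> complex) \<Rightarrow> bool" where
  "piecewise_immersion f \<longleftrightarrow> continuous_on UNIV f \<and>
     (\<forall>t. \<forall>\<F>\<in>{at_left t, at_right t}.
        (\<forall>\<^sub>F x in \<F>. f differentiable (at x)) \<and>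
        (\<exists>u. u \<noteq> 0 \<and> ((\<lambda>x. vector_derivative f (at x)) \<longlongrightarrow> u) \<F>))"

definition crossings :: "diagram \<Rightarrow> complex set" where
  "crossings D = {c. \<exists>s t. s - t \<notin> \<int> \<and> curve D s = c \<and> curve D t = c}"

text \<open>The determinant of the pair of plane vectors \<open>u\<close>, \<open>v\<close>.\<close>

definition det2 :: "complex \<Rightarrow> complex \<Rightarrow> real" where
  "det2 u v = Re u * Im v - Im u * Re v"

text \<open>
  In the last condition but one, of any two distinct strands through a point exactly one is over.
  In particular no three strands meet in a point.
\<close>

definition knot_diagram :: "diagram \<Rightarrow> bool" where
  "knot_diagram D \<longleftrightarrow>
     (\<forall>t. curve D (t + 1) = curve D t) \<and>
     (\<forall>t. t + 1 \<in> over D \<longleftrightarrow> t \<in> over D) \<and>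
     piecewise_immersion (curve D) \<and>
     finite (crossings D) \<and>
     (\<forall>s t. s - t \<notin> \<int> \<and> curve D s = curve D t \<longrightarrow>
        curve D differentiable (at s) \<and> curve D differentiable (at t) \<and>
        det2 (vector_derivative (curve D) (at s)) (vector_derivative (curve D) (at t)) \<noteq> 0) \<and>
     (\<forall>s t. s - t \<notin> \<int> \<and> curve D s = curve D t \<longrightarrow> (s \<in> over D \<longleftrightarrow> t \<notin> over D)) \<and>
     (\<forall>t \<in> over D. curve D t \<in> crossings D)"

definition over_tangent :: "diagram \<Rightarrow> complex \<Rightarrow> complex" where
  "over_tangent D c =
     vector_derivative (curve D) (at (THE t. t \<in> {0..<1} \<and> curve D t = c \<and> t \<in> over D))"

definition under_tangent :: "diagram \<Rightarrow> complex \<Rightarrow> complex" where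
  "under_tangent D c =
     vector_derivative (curve D) (at (THE t. t \<in> {0..<1} \<and> curve D t = c \<and> t \<notin> over D))"

text \<open>
  Positive crossing: the overstrand is turned counterclockwise (by less than a half turn) to the
  understrand.
\<close>

definition crossing_sign :: "diagram \<Rightarrow> complex \<Rightarrow> real" where
  "crossing_sign D c = sgn (det2 (over_tangent D c) (under_tangent D c))"

definition regions :: "diagram \<Rightarrow> complex set set" where
  "regions D = components (- range (curve D))"

text \<open>
  \<^const>\<open>winding_number\<close> only looks at the curve on the unit interval, that is, on one period. It is
  a complex number in the library, but an integer for closed curves.
\<close>

definition region_index :: "diagram \<Rightarrow> complex set \<Rightarrow> real" where
  "region_index D R = Re (winding_number (curve D) (SOME z. z \<in> R))"

text \<open>
  The region that one enters on leaving the point \<open>c\<close> of the curve in direction \<open>w\<close>. At a crossing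
  with tangent vectors \<open>u\<close>, \<open>v\<close>, the four directions \<open>\<plusminus>u \<plusminus> v\<close> point into the four corners, so that
  a region occupying several corners is counted with its multiplicity.
\<close>

definition region_towards :: "diagram \<Rightarrow> complex \<Rightarrow> complex \<Rightarrow> complex set" where
  "region_towards D c w =
     (THE R. R \<in> regions D \<and> (\<forall>\<^sub>F \<epsilon> in at_right 0. c + \<epsilon> *\<^sub>R w \<in> R))"

definition crossing_index :: "diagram \<Rightarrow> complex \<Rightarrow> real" where
  "crossing_index D c =
     (\<Sum>i\<in>{-1, 1}. \<Sum>j\<in>{-1, 1}.
        region_index D (region_towards D c (i *\<^sub>R over_tangent D c + j *\<^sub>R under_tangent D c))) / 4"

definition SCI :: "diagram \<Rightarrow> real" where
  "SCI D = (\<Sum>c\<in>crossings D. crossing_sign D c * crossing_index D c)"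

text \<open>
  Diagrams are moved to their place by orientation-preserving diffeomorphisms of the plane. These
  are exactly the end maps of planar isotopies. The inverse of \<open>h\<close> is C1 by the inverse function
  theorem.
\<close>

definition plane_diffeo :: "(complex \<Rightarrow> complex) \<Rightarrow> bool" where
  "plane_diffeo h \<longleftrightarrow> bij h \<and>
     (\<exists>h' :: complex \<Rightarrow> complex \<Rightarrow>\<^sub>L complex. continuous_on UNIV h' \<and>
        (\<forall>z. (h has_derivative blinfun_apply (h' z)) (at z) \<and>
             det2 (blinfun_apply (h' z) 1) (blinfun_apply (h' z) \<i>) > 0))"

definition move :: "(complex \<Rightarrow> complex) \<Rightarrow> diagram \<Rightarrow> diagram" where
  "move h D = D\<lparr>curve := h \<circ> curve D\<rparr>"

text \<open>On \<open>{x..y}\<close>, \<open>f\<close> runs through the values of \<open>g\<close> on \<open>{u..v}\<close>, in the same direction.\<close>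

definition runs_along :: "(real \<Rightarrow> 'a) \<Rightarrow> real \<Rightarrow> real \<Rightarrow> (real \<Rightarrow> 'a) \<Rightarrow> real \<Rightarrow> real \<Rightarrow> bool" where
  "runs_along f x y g u v \<longleftrightarrow>
     (\<exists>\<phi>. continuous_on {x..y} \<phi> \<and> strict_mono_on {x..y} \<phi> \<and> \<phi> x = u \<and> \<phi> y = v \<and>
        (\<forall>t\<in>{x..y}. f t = g (\<phi> t)))"

definition strands :: "diagram \<Rightarrow> real \<Rightarrow> complex \<times> bool" where
  "strands D t = (curve D t, t \<in> over D)"

text \<open>
  \<open>F\<close> arises from \<open>D\<close> and \<open>E\<close>, which lie in disjoint half-planes, by a band \<open>\<beta>\<close>, an embedded unit
  square. Its left side is the arc of \<open>D\<close> over \<open>{a..b}\<close>, and its right side is the arc of \<open>E\<close> over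
  \<open>{c..d}\<close> traversed backwards. These arcs contain no crossings, so each lies in an edge; the rest
  of the band lies in the unbounded region, so these edges are adjacent to it. \<open>F\<close> runs along the
  rest of \<open>D\<close>, the bottom side of the band, the rest of \<open>E\<close> and the top side of the band backwards.
  The band is only required to be a topological embedding, which allows \<open>F\<close> to be rounded off at the
  attaching points.
\<close>

definition band_sum :: "diagram \<Rightarrow> diagram \<Rightarrow> diagram \<Rightarrow> bool" where
  "band_sum D E F \<longleftrightarrow>
     (\<exists>n k. n \<noteq> 0 \<and> range (curve D) \<subseteq> {z. n \<bullet> z < k} \<and> range (curve E) \<subseteq> {z. n \<bullet> z > k}) \<and>
     (\<exists>(\<beta> :: real \<times> real \<Rightarrow> complex) a b c d t0 t1 t2 t3.
        continuous_on ({0..1} \<times> {0..1}) \<beta> \<and> inj_on \<beta> ({0..1} \<times> {0..1}) \<and>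
        a < b \<and> b < a + 1 \<and> (\<forall>t\<in>{a..b}. curve D t \<notin> crossings D) \<and>
        c < d \<and> d < c + 1 \<and> (\<forall>t\<in>{c..d}. curve E t \<notin> crossings E) \<and>
        (\<forall>t\<in>{0..1}. \<beta> (0, t) = curve D (a + t * (b - a))) \<and>
        (\<forall>t\<in>{0..1}. \<beta> (1, t) = curve E (d - t * (d - c))) \<and>
        \<beta> ` ({0<..<1} \<times> {0..1}) \<subseteq> outside (range (curve D) \<union> range (curve E)) \<and>
        t0 < t1 \<and> t1 < t2 \<and> t2 < t3 \<and> t3 < t0 + 1 \<and>
        runs_along (strands F) t0 t1 (strands D) b (a + 1) \<and>
        runs_along (curve F) t1 t2 (\<lambda>s. \<beta> (s, 0)) 0 1 \<and>
        runs_along (strands F) t2 t3 (strands E) d (c + 1) \<and>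
        runs_along (curve F) t3 (t0 + 1) (\<lambda>s. \<beta> (1 - s, 1)) 0 1)"

text \<open>\<open>F\<close> is one of the connected sums \<open>D # E\<close>.\<close>

definition connected_sum :: "diagram \<Rightarrow> diagram \<Rightarrow> diagram \<Rightarrow> bool" where
  "connected_sum D E F \<longleftrightarrow> knot_diagram F \<and>
     (\<exists>g h. plane_diffeo g \<and> plane_diffeo h \<and> band_sum (move g D) (move h E) F)"

end

theory Submission
  imports Defs
begin

text \<open>
  The sum \<^const>\<open>SCI\<close> only sees the diagram near its crossings: each crossing contributes its sign
  times the average of four winding numbers. The connected sum neither creates nor destroys
  crossings, so it suffices that each crossing contributes the same before and after.

  Two constructions have to be controlled. A diffeomorphism \<open>h\<close> with positive Jacobian preserves
  winding numbers (\<open>winding_number_diffeo_image\<close>): a loop around \<open>z\<close> contracts, in the punctured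
  plane, onto a small circle run through a number of times, and near \<open>z\<close> the map \<open>h\<close> is a small
  perturbation of a real-linear map of positive determinant, which is in turn homotopic to a complex
  multiplication. As the derivative of \<open>h\<close> also preserves the orientation of the two tangents at a
  crossing, \<^const>\<open>SCI\<close> is unchanged (\<open>SCI_move\<close>).

  The other is the band. As cycles, \<open>F\<close> is \<open>D + E\<close> plus the boundary of the band, and the boundary is
  contractible within the band, so that off the band winding numbers add up
  (\<open>winding_number_band_sum\<close>). A crossing of \<open>D\<close> is neither on the band nor in the half-plane
  of \<open>E\<close>, where alone \<open>E\<close> can have a nonzero winding number; hence \<open>F\<close> and \<open>D\<close> have the
  same winding numbers close to it.

  Both arguments need to read off the index of a corner from winding numbers at nearby points, not
  just at points on one ray. That is \<open>corner_index_eq_winding_number\<close>: for a compact connected set of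
  directions none of which is tangent to the curve, all points in these directions and close enough
  to the crossing lie in one and the same region. It absorbs the error of linearizing \<open>h\<close>, and the
  fact that \<open>F\<close> may run through the strands of \<open>D\<close> at different speeds, which
  rescales the tangents \<open>u\<close> and \<open>v\<close> by positive factors and so moves the directions \<open>\<plusminus>u \<plusminus> v\<close>.
\<close>

section \<open>Determinants and real-linear maps of the plane\<close>

lemma det2_simps:
  "det2 (r *\<^sub>R u) v = r * det2 u v" "det2 u (r *\<^sub>R v) = r * det2 u v"
  "det2 (u + u') v = det2 u v + det2 u' v" "det2 u (v + v') = det2 u v + det2 u v'"
  "det2 (u - u') v = det2 u v - det2 u' v" "det2 u (v - v') = det2 u v - det2 u v'"
  "det2 u u = 0" "det2 0 u = 0" "det2 u 0 = 0"
  by (simp_all add: det2_def algebra_simps)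

lemma det2_commute: "det2 v u = - det2 u v"
  by (simp add: det2_def)

lemma abs_det2_le: "\<bar>det2 u v\<bar> \<le> cmod u * cmod v"
proof -
  have "det2 u v = Im (cnj u * v)" by (simp add: det2_def)
  then show ?thesis using abs_Im_le_cmod[of "cnj u * v"] by (simp add: norm_mult)
qed

lemma continuous_on_det2 [continuous_intros]:
  "continuous_on A f \<Longrightarrow> continuous_on A g \<Longrightarrow> continuous_on A (\<lambda>x. det2 (f x) (g x))"
  unfolding det2_def by (intro continuous_intros)

lemma real_linear_complex_decomposition:
  fixes L :: "complex \<Rightarrow> complex"
  assumes "linear L"
  defines "a \<equiv> (L 1 - \<i> * L \<i>) / 2" and "b \<equiv> (L 1 + \<i> * L \<i>) / 2"
  shows "L w = a * w + b * cnj w" and "(cmod a)\<^sup>2 - (cmod b)\<^sup>2 = det2 (L 1) (L \<i>)"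
proof -
  have "L w = L (Re w *\<^sub>R 1 + Im w *\<^sub>R \<i>)"
    by (rule arg_cong[where f = L]) (simp add: complex_eq_iff)
  also have "\<dots> = Re w *\<^sub>R L 1 + Im w *\<^sub>R L \<i>"
    by (simp only: linear_add[OF assms(1)] linear_scale[OF assms(1)])
  also have "\<dots> = a * w + b * cnj w"
    unfolding a_def b_def by (simp add: complex_eq_iff algebra_simps flip: add_divide_distrib)
  finally show "L w = a * w + b * cnj w" .
  show "(cmod a)\<^sup>2 - (cmod b)\<^sup>2 = det2 (L 1) (L \<i>)"
    unfolding a_def b_def det2_def cmod_power2 by (simp add: power2_eq_square field_simps)
qed

lemma linear_det2:
  fixes L :: "complex \<Rightarrow> complex"
  assumes "linear L"
  shows "det2 (L u) (L v) = det2 (L 1) (L \<i>) * det2 u v"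
proof -
  have "L w = Re w *\<^sub>R L 1 + Im w *\<^sub>R L \<i>" for w
    using real_linear_complex_decomposition(1)[OF assms, of w]
    by (simp add: complex_eq_iff field_simps)
  then have *: "Re (L w) = Re w * Re (L 1) + Im w * Re (L \<i>)" "Im (L w) = Re w * Im (L 1) + Im w * Im (L \<i>)" for w
    by (metis plus_complex.simps scaleR_complex.simps)+
  show ?thesis
    unfolding det2_def *[of u] *[of v] by algebra
qed

section \<open>Winding numbers\<close>

text \<open>
  Any loop around \<open>z\<close> is homotopic in the punctured plane to the loop \<open>q\<close> below, which runs along a
  circle around \<open>z\<close>. The circle can be chosen so small that on it \<open>h\<close> differs from
  \<open>w \<mapsto> h z + a * (w - z)\<close> by less than \<open>\<bar>a\<bar> * \<bar>w - z\<bar>\<close>, where \<open>a\<close> is the complex-linear part of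
  the derivative: it dominates the antilinear part \<open>b\<close> because the determinant is
  \<open>\<bar>a\<bar>\<^sup>2 - \<bar>b\<bar>\<^sup>2\<close>.
\<close>

lemma winding_number_diffeo_image:
  assumes "continuous_on UNIV h" "inj h"
    and deriv: "(h has_derivative L) (at z)" and pos: "det2 (L 1) (L \<i>) > 0"
    and "path \<gamma>" and loop: "pathfinish \<gamma> = pathstart \<gamma>" and z: "z \<notin> path_image \<gamma>"
  shows "winding_number (h \<circ> \<gamma>) (h z) = winding_number \<gamma> z"
proof -
  have "linear L" using deriv by (rule has_derivative_linear)
  define a b where "a = (L 1 - \<i> * L \<i>) / 2" and "b = (L 1 + \<i> * L \<i>) / 2"
  have L: "L w = a * w + b * cnj w" for w
    unfolding a_def b_def by (rule real_linear_complex_decomposition[OF \<open>linear L\<close>])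
  have "(cmod a)\<^sup>2 - (cmod b)\<^sup>2 > 0"
    using pos unfolding a_def b_def real_linear_complex_decomposition(2)[OF \<open>linear L\<close>] .
  then have ab: "cmod b < cmod a"
    by (simp add: power2_less_imp_less)
  then have "a \<noteq> 0" by auto
  \<comment> \<open>Bound on the relative error of the derivative, small enough for \<open>\<epsilon> + \<bar>b\<bar> < \<bar>a\<bar>\<close>.\<close>
  define \<epsilon> where "\<epsilon> = (cmod a - cmod b) / 2"
  have "\<epsilon> > 0" using ab by (simp add: \<epsilon>_def)
  then obtain d where "d > 0" and d: "\<And>y. cmod (y - z) < d \<Longrightarrow> cmod (h y - h z - L (y - z)) \<le> \<epsilon> * cmod (y - z)"
    using deriv unfolding has_derivative_at_alt by blast
  define n where "n = winding_number \<gamma> z"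
  have n: "n \<in> \<int>" using integer_winding_number assms by (simp add: n_def)
  \<comment> \<open>The logarithm of the circle: its exponential has radius \<open>d / 2\<close> and winds \<open>n\<close> times around 0.\<close>
  define l where "l = linepath (of_real (ln (d / 2))) (of_real (ln (d / 2)) + 2 * of_real pi * \<i> * n)"
  define c where "c = exp \<circ> l"
  have wl: "winding_number (exp \<circ> (\<lambda>x. q + l x)) 0 = n" for q
  proof -
    have "path (\<lambda>x. q + l x)" unfolding l_def path_def by (intro continuous_intros)
    from winding_number_compose_exp[OF this] show ?thesis
      by (simp add: pathfinish_def pathstart_def l_def linepath_def)
  qed
  have nr: "Im n = 0" using n by (auto elim: Ints_cases)
  have cmodc: "cmod (c x) = d / 2" for x
    using \<open>d > 0\<close> nr by (simp add: c_def l_def linepath_def algebra_simps)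
  have cne: "c x \<noteq> 0" for x using cmodc[of x] \<open>d > 0\<close> by auto
  have pc: "path c" unfolding c_def l_def path_def o_def by (intro continuous_intros)
  have "exp (2 * of_real pi * \<i> * n) = 1"
    using n by (auto elim!: Ints_cases simp: exp_eq_1)
  then have lc: "pathfinish c = pathstart c"
    by (simp add: pathfinish_def pathstart_def c_def l_def linepath_def exp_add)
  define q where "q = (\<lambda>x. z + c x)"
  have pq: "path q" "pathfinish q = pathstart q" "z \<notin> path_image q"
    using pc lc cne unfolding q_def path_def pathfinish_def pathstart_def path_image_def
    by (auto intro!: continuous_intros)
  have "winding_number q z = winding_number c 0"
    by (simp add: q_def winding_number_offset[of _ z])
  also have "\<dots> = n" using wl[of 0] by (simp add: c_def)
  finally have "homotopic_loops (- {z}) \<gamma> q"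
    using winding_number_homotopic_loops_eq[OF \<open>path \<gamma>\<close> z pq(1,3) loop pq(2)] by (simp add: n_def)
  then have "homotopic_loops (- {h z}) (h \<circ> \<gamma>) (h \<circ> q)"
    by (rule homotopic_loops_continuous_image)
       (use assms(1,2) in \<open>auto intro: continuous_on_subset dest: injD\<close>)
  then have "winding_number (h \<circ> \<gamma>) (h z) = winding_number (h \<circ> q) (h z)"
    by (rule winding_number_homotopic_loops)
  also have "\<dots> = winding_number (\<lambda>x. h (z + c x) - h z) 0"
    by (simp add: q_def winding_number_offset[of _ "h z"] o_def)
  also have "\<dots> = winding_number (\<lambda>x. a * c x) 0"
  proof (rule winding_number_homotopic_loops[symmetric], rule homotopic_loops_nearby_explicit)
    show "path (\<lambda>x. a * c x)" using pc unfolding path_def by (intro continuous_intros)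
    show "path (\<lambda>x. h (z + c x) - h z)" using pc unfolding path_def
      by (intro continuous_intros continuous_on_compose2[OF assms(1)]) auto
    show "pathfinish (\<lambda>x. a * c x) = pathstart (\<lambda>x. a * c x)"
      "pathfinish (\<lambda>x. h (z + c x) - h z) = pathstart (\<lambda>x. h (z + c x) - h z)"
      using lc by (simp_all add: pathfinish_def pathstart_def)
    fix t :: real and x :: complex assume "x \<notin> - {0}"
    have "cmod (h (z + c t) - h z - L (c t)) \<le> \<epsilon> * cmod (c t)"
      using d[of "z + c t"] cmodc[of t] \<open>d > 0\<close> by (simp only: add_diff_cancel_left')
    moreover have "cmod (L (c t) - a * c t) = cmod b * cmod (c t)"
      by (simp add: L norm_mult)
    moreover have "h (z + c t) - h z - a * c t = (h (z + c t) - h z - L (c t)) + (L (c t) - a * c t)"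
      by simp
    ultimately have "cmod (h (z + c t) - h z - a * c t) \<le> (\<epsilon> + cmod b) * cmod (c t)"
      by (smt (verit) norm_triangle_ineq distrib_right)
    also have "\<dots> < cmod a * cmod (c t)"
      using ab cne[of t] by (intro mult_strict_right_mono) (auto simp: \<epsilon>_def field_simps)
    finally show "cmod (h (z + c t) - h z - a * c t) < cmod (a * c t - x)"
      using \<open>x \<notin> - {0}\<close> by (simp add: norm_mult)
  qed
  also have "(\<lambda>x. a * c x) = exp \<circ> (\<lambda>x. Ln a + l x)"
    using \<open>a \<noteq> 0\<close> by (auto simp: c_def exp_add)
  finally show ?thesis using wl[of "Ln a"] by (simp add: n_def o_def)
qed

lemma affine_mem_interval:
  fixes x y s :: real
  assumes "x < y" "s \<in> {0..1}"
  shows "(y - x) * s + x \<in> {x..y}"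
proof -
  have "0 \<le> (y - x) * s" using assms by simp
  moreover have "(y - x) * s \<le> y - x" using assms by (intro mult_left_le) auto
  ultimately have "x \<le> (y - x) * s + x" "(y - x) * s + x \<le> y" by linarith+
  then show ?thesis by simp
qed

lemma winding_number_subpath_append:
  assumes "continuous_on {x..z} f" "x \<le> y" "y \<le> z" "p \<notin> f ` {x..z}"
  shows "winding_number (subpath x y f) p + winding_number (subpath y z f) p = winding_number (subpath x z f) p"
proof (cases "x = z")
  case True
  then show ?thesis using assms by auto
next
  case False
  then have xz: "x < z" using assms by auto
  define g where "g = subpath x z f"
  have img: "path_image g = f ` {x..z}"
    unfolding g_def using path_image_subpath[of x z f] xz by simp
  have pg: "path g" unfolding g_def path_def subpath_def
  proof (rule continuous_on_compose2[OF assms(1)])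
    show "(\<lambda>s. (z - x) * s + x) ` {0..1} \<subseteq> {x..z}"
      using affine_mem_interval[OF xz] by blast
  qed (intro continuous_intros)
  have sub: "subpath ((u - x) / (z - x)) ((v - x) / (z - x)) g = subpath u v f" for u v
  proof
    fix s
    have "(z - x) * (((v - x) / (z - x) - (u - x) / (z - x)) * s + (u - x) / (z - x)) + x = (v - u) * s + u"
      using xz by (simp add: divide_simps)
    then show "subpath ((u - x) / (z - x)) ((v - x) / (z - x)) g s = subpath u v f s"
      unfolding subpath_def g_def by simp
  qed
  have "winding_number (subpath ((x - x) / (z - x)) ((y - x) / (z - x)) g) p +
      winding_number (subpath ((y - x) / (z - x)) ((z - x) / (z - x)) g) p =
      winding_number (subpath ((x - x) / (z - x)) ((z - x) / (z - x)) g) p"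
    by (rule winding_number_subpath_combine) (use pg img assms xz in \<open>auto simp: divide_simps\<close>)
  then show ?thesis unfolding sub .
qed

lemma periodic_Ints:
  fixes f :: "real \<Rightarrow> 'a"
  assumes per: "\<And>t. f (t + 1) = f t" and "s - t \<in> \<int>"
  shows "f s = f t"
proof -
  have shift: "f (t + of_int k) = f t" for k
  proof (induction k rule: int_induct[where k = 0])
    case (step1 i) then show ?case using per[of "t + of_int i"] by (simp add: algebra_simps)
  next
    case (step2 i) then show ?case using per[of "t + of_int (i - 1)"] by (simp add: algebra_simps)
  qed simp
  obtain k where "s - t = of_int k" using assms(2) by (auto elim: Ints_cases)
  then have "s = t + of_int k" by simp
  then show ?thesis using shift by simp
qed

text \<open>
  With \<open>m\<close> the integer part of \<open>x\<close>, the part of the period beyond \<open>m + 1\<close> is a translate of the part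
  of \<open>{m..m + 1}\<close> before \<open>x\<close>.
\<close>

lemma winding_number_one_period:
  fixes f :: "real \<Rightarrow> complex"
  assumes cont: "continuous_on UNIV f" and per: "\<And>t. f (t + 1) = f t" and "p \<notin> range f"
  shows "winding_number (subpath x (x + 1) f) p = winding_number f p"
proof -
  have shift: "f (t + of_int k) = f t" for t k
    by (rule periodic_Ints[of f, OF per]) simp
  have sub: "subpath (u + of_int k) (v + of_int k) f = subpath u v f" for u v k
    unfolding subpath_def using shift by (metis add.assoc add_diff_cancel_right)
  have app: "winding_number (subpath u v f) p + winding_number (subpath v w f) p = winding_number (subpath u w f) p"
    if "u \<le> v" "v \<le> w" for u v w
    using that assms(1,3) by (intro winding_number_subpath_append) (auto intro: continuous_on_subset)
  define m where "m = \<lfloor>x\<rfloor>"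
  have m: "of_int m \<le> x" "x \<le> of_int m + 1" unfolding m_def by linarith+
  have "winding_number (subpath x (x + 1) f) p =
      winding_number (subpath x (of_int m + 1) f) p + winding_number (subpath (of_int m + 1) (x + 1) f) p"
    using m by (simp add: app)
  also have "subpath (of_int m + 1) (x + 1) f = subpath (of_int m) x f"
    using sub[of "of_int m" 1 x] by simp
  also have "winding_number (subpath x (of_int m + 1) f) p + winding_number (subpath (of_int m) x f) p =
      winding_number (subpath (of_int m) (of_int m + 1) f) p"
    using app[OF m] by (simp add: add.commute)
  also have "subpath (of_int m) (of_int m + 1) f = f"
    using sub[of 0 m 1] by (simp add: add.commute)
  finally show ?thesis .
qed

lemma winding_number_runs_along:
  fixes f g :: "real \<Rightarrow> complex"
  assumes "runs_along f x y g u v" "x < y" "continuous_on {u..v} g" "p \<notin> g ` {u..v}"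
  shows "winding_number (subpath x y f) p = winding_number (subpath u v g) p"
proof -
  obtain \<phi> where phi: "continuous_on {x..y} \<phi>" "strict_mono_on {x..y} \<phi>" "\<phi> x = u" "\<phi> y = v"
      "\<And>t. t \<in> {x..y} \<Longrightarrow> f t = g (\<phi> t)"
    using assms(1) unfolding runs_along_def by blast
  have "u < v" using strict_mono_onD[OF phi(2), of x y] phi(3,4) \<open>x < y\<close> by auto
  define \<psi> where "\<psi> s = (\<phi> ((y - x) * s + x) - u) / (v - u)" for s
  have rng: "\<phi> t \<in> {u..v}" if "t \<in> {x..y}" for t
    using that phi \<open>x < y\<close> strict_mono_on_imp_mono_on[OF phi(2)] by (auto simp: mono_on_def)
  have "homotopic_paths (- {p}) (subpath u v g) (subpath x y f)"
  proof (rule homotopic_paths_reparametrize)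
    show "path (subpath u v g)" unfolding path_def subpath_def
      by (rule continuous_on_compose2[OF assms(3)]) (use affine_mem_interval[OF \<open>u < v\<close>] in \<open>auto intro!: continuous_intros\<close>)
    show "path_image (subpath u v g) \<subseteq> - {p}"
      using assms(4) \<open>u < v\<close> path_image_subpath[of u v g] by auto
    show "continuous_on {0..1} \<psi>" unfolding \<psi>_def
      by (intro continuous_intros continuous_on_compose2[OF phi(1)]) (use affine_mem_interval[OF \<open>x < y\<close>] \<open>u < v\<close> in auto)
    show "\<psi> \<in> {0..1} \<rightarrow> {0..1}"
      using rng[OF affine_mem_interval[OF \<open>x < y\<close>]] \<open>u < v\<close> by (auto simp: \<psi>_def divide_simps)
    show "\<psi> 0 = 0" "\<psi> 1 = 1" using phi(3,4) \<open>u < v\<close> by (auto simp: \<psi>_def)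
    fix s :: real assume "s \<in> {0..1}"
    then show "subpath x y f s = subpath u v g (\<psi> s)"
      using phi(5)[OF affine_mem_interval[OF \<open>x < y\<close>]] \<open>u < v\<close> by (simp add: subpath_def \<psi>_def)
  qed
  then show ?thesis by (simp add: winding_number_homotopic_paths)
qed

section \<open>Crossings and their tangents\<close>

text \<open>
  The part of \<^const>\<open>knot_diagram\<close> on which \<^const>\<open>SCI\<close> depends. It passes to the image under a
  diffeomorphism without any discussion of corners of the curve.
\<close>

definition transverse_diagram :: "diagram \<Rightarrow> bool" where
  "transverse_diagram D \<longleftrightarrow>
     (\<forall>t. curve D (t + 1) = curve D t) \<and>
     (\<forall>t. t + 1 \<in> over D \<longleftrightarrow> t \<in> over D) \<and>
     continuous_on UNIV (curve D) \<and>
     (\<forall>s t. s - t \<notin> \<int> \<and> curve D s = curve D t \<longrightarrow>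
        curve D differentiable (at s) \<and> curve D differentiable (at t) \<and>
        det2 (vector_derivative (curve D) (at s)) (vector_derivative (curve D) (at t)) \<noteq> 0) \<and>
     (\<forall>s t. s - t \<notin> \<int> \<and> curve D s = curve D t \<longrightarrow> (s \<in> over D \<longleftrightarrow> t \<notin> over D))"

lemma knot_diagram_imp_transverse: "knot_diagram D \<Longrightarrow> transverse_diagram D"
  unfolding knot_diagram_def transverse_diagram_def piecewise_immersion_def by blast

lemma exists_shift_into_period:
  fixes s x :: real
  obtains t where "t - s \<in> \<int>" "x \<le> t" "t < x + 1"
proof
  show "(s - of_int \<lfloor>s - x\<rfloor>) - s \<in> \<int>" by simp
  show "x \<le> s - of_int \<lfloor>s - x\<rfloor>" "s - of_int \<lfloor>s - x\<rfloor> < x + 1" by linarith+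
qed

lemma Ints_diff_trans: "r - s \<in> \<int> \<Longrightarrow> s - t \<in> \<int> \<Longrightarrow> r - (t::real) \<in> \<int>"
  by (drule (1) Ints_add) simp

lemma Ints_diff_sym: "r - s \<in> \<int> \<Longrightarrow> s - (r::real) \<in> \<int>"
  by (drule Ints_minus) simp

lemma nonzero_less_1_notin_Ints: "s \<noteq> t \<Longrightarrow> \<bar>s - t\<bar> < 1 \<Longrightarrow> s - (t::real) \<notin> \<int>"
  by (meson eq_iff_diff_eq_0 Ints_nonzero_abs_less1)

context
  fixes D assumes D: "transverse_diagram D"
begin

lemma transverse_periodic: "s - t \<in> \<int> \<Longrightarrow> curve D s = curve D t"
  using D periodic_Ints[of "curve D"] unfolding transverse_diagram_def by blast

lemma transverse_over_periodic: "s - t \<in> \<int> \<Longrightarrow> s \<in> over D \<longleftrightarrow> t \<in> over D"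
  using D periodic_Ints[of "\<lambda>t. t \<in> over D"] unfolding transverse_diagram_def by blast

lemma transverse_continuous: "continuous_on A (curve D)"
  using D continuous_on_subset unfolding transverse_diagram_def by blast

lemma transverse_over_iff: "s - t \<notin> \<int> \<Longrightarrow> curve D s = curve D t \<Longrightarrow> s \<in> over D \<longleftrightarrow> t \<notin> over D"
  using D unfolding transverse_diagram_def by blast

lemma transverse_differentiable:
  "s - t \<notin> \<int> \<Longrightarrow> curve D s = curve D t \<Longrightarrow> (curve D has_vector_derivative vector_derivative (curve D) (at s)) (at s)"
  using D unfolding transverse_diagram_def by (meson vector_derivative_works)

lemma transverse_det:
  "s - t \<notin> \<int> \<Longrightarrow> curve D s = curve D t \<Longrightarrow> det2 (vector_derivative (curve D) (at s)) (vector_derivative (curve D) (at t)) \<noteq> 0"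
  using D unfolding transverse_diagram_def by blast

lemma transverse_derivative_periodic:
  assumes "s - t \<in> \<int>"
  shows "vector_derivative (curve D) (at s) = vector_derivative (curve D) (at t)"
proof -
  have "(curve D has_vector_derivative v) (at s) \<longleftrightarrow> (curve D has_vector_derivative v) (at t)"
    if "s - t \<in> \<int>" for s t v
  proof -
    have *: "(curve D has_vector_derivative v) (at (t + c))"
      if "(curve D has_vector_derivative v) (at t)" "c \<in> \<int>" for t c
    proof -
      have "((\<lambda>r. curve D (r - c)) has_vector_derivative 1 *\<^sub>R v) (at (t + c))"
        by (rule vector_diff_chain_at[where g = "curve D" and f = "\<lambda>r. r - c", unfolded o_def])
           (use that in \<open>auto intro!: derivative_eq_intros\<close>)
      moreover have "(\<lambda>r. curve D (r - c)) = curve D"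
        using transverse_periodic that(2) by (auto intro!: ext)
      ultimately show ?thesis by simp
    qed
    from *[of t "s - t"] *[of s "t - s"] that Ints_diff_sym[OF that] show ?thesis by auto
  qed
  then show ?thesis using assms unfolding vector_derivative_def by presburger
qed

lemma crossing_parameters:
  assumes "c \<in> crossings D"
  obtains s t where "s - t \<notin> \<int>" "curve D s = c" "curve D t = c" "s \<in> over D" "t \<notin> over D"
proof -
  from assms obtain s t where st: "s - t \<notin> \<int>" "curve D s = c" "curve D t = c"
    unfolding crossings_def by blast
  moreover have "t - s \<notin> \<int>" using st(1) Ints_diff_sym by blast
  ultimately show ?thesis
    using that transverse_over_iff[of s t] by metis
qed

text \<open>Of three different strands, two would be both over or both under.\<close>

lemma crossing_two_strands:
  assumes "s - t \<notin> \<int>" "curve D s = curve D t" "curve D r = curve D t"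
  shows "r - s \<in> \<int> \<or> r - t \<in> \<int>"
  using transverse_over_iff[of s t] transverse_over_iff[of r s] transverse_over_iff[of r t] assms by auto

text \<open>
  The definitions of the tangents choose the parameter within \<open>{0..<1}\<close>; by periodicity any
  parameters of the two strands give the same vectors.
\<close>

lemma crossing_tangents:
  assumes st: "s - t \<notin> \<int>" "curve D s = c" "curve D t = c" "s \<in> over D" "t \<notin> over D"
  shows "over_tangent D c = vector_derivative (curve D) (at s)"
    and "under_tangent D c = vector_derivative (curve D) (at t)"
proof -
  have *: "(THE r. r \<in> {0..<1} \<and> curve D r = c \<and> (r \<in> over D \<longleftrightarrow> b)) - p \<in> \<int>"
    if p: "curve D p = c" "p \<in> over D \<longleftrightarrow> b" for p b
  proof -
    obtain q where q: "q - p \<in> \<int>" "0 \<le> q" "q < 0 + 1" using exists_shift_into_period .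
    have "(THE r. r \<in> {0..<1} \<and> curve D r = c \<and> (r \<in> over D \<longleftrightarrow> b)) = q"
    proof (rule the_equality)
      show "q \<in> {0..<1} \<and> curve D q = c \<and> (q \<in> over D \<longleftrightarrow> b)"
        using q p transverse_periodic transverse_over_periodic by auto
      then show "r = q" if "r \<in> {0..<1} \<and> curve D r = c \<and> (r \<in> over D \<longleftrightarrow> b)" for r
        using that transverse_over_iff[of r q] nonzero_less_1_notin_Ints[of r q] by fastforce
    qed
    with q show ?thesis by simp
  qed
  show "over_tangent D c = vector_derivative (curve D) (at s)"
    unfolding over_tangent_def using *[of s True] st by (intro transverse_derivative_periodic) simp
  show "under_tangent D c = vector_derivative (curve D) (at t)"
    unfolding under_tangent_def using *[of t False] st by (intro transverse_derivative_periodic) simp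
qed

end

section \<open>The corners at a crossing\<close>

text \<open>
  The determinant with the tangent \<open>u\<close> vanishes on \<open>u\<close> itself, so at a point \<open>f r\<close> it is of smaller
  order than \<open>\<bar>r - s\<bar>\<close>, whereas on the cone over \<open>K\<close> it is at least a fixed multiple \<open>m\<close> of the
  distance to the apex, which is comparable with \<open>\<bar>r - s\<bar>\<close>.
\<close>

lemma curve_leaves_cone:
  fixes f :: "real \<Rightarrow> complex"
  assumes deriv: "(f has_vector_derivative u) (at s)" and K: "compact K"
    and det: "\<And>w. w \<in> K \<Longrightarrow> det2 w u \<noteq> 0"
  obtains \<eta> where "\<eta> > 0" "\<And>r \<epsilon> w. \<bar>r - s\<bar> < \<eta> \<Longrightarrow> \<epsilon> > 0 \<Longrightarrow> w \<in> K \<Longrightarrow> f r \<noteq> f s + \<epsilon> *\<^sub>R w"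
proof (cases "K = {}")
  case True
  then show ?thesis using that[of 1] by simp
next
  case False
  have K0: "0 \<notin> K" using det[of 0] by (auto simp: det2_simps)
  have "u \<noteq> 0" using det False by (auto simp: det2_simps)
  obtain m where "m > 0" and m: "\<And>w. w \<in> K \<Longrightarrow> m * cmod w \<le> \<bar>det2 w u\<bar>"
  proof -
    have "continuous_on K (\<lambda>w. \<bar>det2 w u\<bar> / cmod w)"
      using K0 by (intro continuous_intros) auto
    from continuous_attains_inf[OF K False this]
    obtain w0 where w0: "w0 \<in> K" "\<And>w. w \<in> K \<Longrightarrow> \<bar>det2 w0 u\<bar> / cmod w0 \<le> \<bar>det2 w u\<bar> / cmod w"
      by blast
    show ?thesis
    proof
      show "\<bar>det2 w0 u\<bar> / cmod w0 > 0"
        using det[OF w0(1)] K0 w0(1) by (intro divide_pos_pos) auto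
      show "\<bar>det2 w0 u\<bar> / cmod w0 * cmod w \<le> \<bar>det2 w u\<bar>" if "w \<in> K" for w
        using w0(2)[OF that] pos_le_divide_eq[of "cmod w"] K0 that by (metis zero_less_norm_iff)
    qed
  qed
  \<comment> \<open>The first bound gives \<open>\<bar>f r - f s\<bar> \<ge> \<bar>r - s\<bar> * \<bar>u\<bar> / 2\<close>, the second one makes the error too small
    for a determinant on the cone.\<close>
  define e where "e = min (cmod u / 2) (m / 3)"
  have "e > 0" using \<open>m > 0\<close> \<open>u \<noteq> 0\<close> by (simp add: e_def)
  then obtain \<eta> where "\<eta> > 0" and \<eta>: "\<And>r. \<bar>r - s\<bar> < \<eta> \<Longrightarrow> cmod (f r - f s - (r - s) *\<^sub>R u) \<le> e * \<bar>r - s\<bar>"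
    using deriv unfolding has_vector_derivative_def has_derivative_at_alt by fastforce
  show ?thesis
  proof
    show "\<eta> > 0" by fact
    show "f r \<noteq> f s + \<epsilon> *\<^sub>R w" if r: "\<bar>r - s\<bar> < \<eta>" and "\<epsilon> > 0" "w \<in> K" for r \<epsilon> w
    proof
      assume eq: "f r = f s + \<epsilon> *\<^sub>R w"
      define rem where "rem = f r - f s - (r - s) *\<^sub>R u"
      have rem: "cmod rem \<le> e * \<bar>r - s\<bar>" using \<eta>[OF r] by (simp add: rem_def)
      have w: "\<epsilon> *\<^sub>R w = (r - s) *\<^sub>R u + rem" using eq by (simp add: rem_def)
      have "r \<noteq> s" using eq \<open>\<epsilon> > 0\<close> \<open>w \<in> K\<close> K0 by auto
      have "cmod ((r - s) *\<^sub>R u) \<le> cmod (\<epsilon> *\<^sub>R w) + cmod rem"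
        unfolding w by (metis add_diff_cancel_right' norm_triangle_ineq4)
      then have "\<bar>r - s\<bar> * cmod u \<le> \<epsilon> * cmod w + e * \<bar>r - s\<bar>"
        using rem \<open>\<epsilon> > 0\<close> by simp
      moreover have "e * \<bar>r - s\<bar> \<le> cmod u / 2 * \<bar>r - s\<bar>"
        by (intro mult_right_mono) (simp_all add: e_def)
      ultimately have "\<bar>r - s\<bar> * cmod u \<le> 2 * (\<epsilon> * cmod w)" by (simp add: algebra_simps)
      then have "m * (\<bar>r - s\<bar> * cmod u) \<le> m * (2 * (\<epsilon> * cmod w))"
        using \<open>m > 0\<close> by simp
      also have "\<dots> = 2 * (\<epsilon> * (m * cmod w))" by simp
      also have "\<dots> \<le> 2 * (\<epsilon> * \<bar>det2 w u\<bar>)" using m[OF \<open>w \<in> K\<close>] \<open>\<epsilon> > 0\<close> by simp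
      also have "\<epsilon> * \<bar>det2 w u\<bar> = \<bar>det2 (\<epsilon> *\<^sub>R w) u\<bar>" using \<open>\<epsilon> > 0\<close> by (simp add: det2_simps abs_mult)
      also have "\<dots> = \<bar>det2 rem u\<bar>" unfolding w by (simp add: det2_simps)
      also have "\<dots> \<le> cmod rem * cmod u" by (rule abs_det2_le)
      also have "\<dots> \<le> (m / 3 * \<bar>r - s\<bar>) * cmod u"
        using rem \<open>e > 0\<close> by (intro mult_right_mono order_trans[OF rem]) (simp_all add: e_def)
      finally have "m * (\<bar>r - s\<bar> * cmod u) \<le> 2 / 3 * (m * (\<bar>r - s\<bar> * cmod u))" by simp
      moreover have "m * (\<bar>r - s\<bar> * cmod u) > 0" using \<open>m > 0\<close> \<open>r \<noteq> s\<close> \<open>u \<noteq> 0\<close> by simp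
      ultimately show False by linarith
    qed
  qed
qed

text \<open>
  By compactness, one has to look only at a neighbourhood of a single parameter \<open>s\<close>. If the curve is at
  the apex there, the previous lemma applies; otherwise the curve stays away from the apex, to
  which the cone shrinks.
\<close>

lemma compact_curve_avoids_cone:
  fixes f :: "real \<Rightarrow> complex"
  assumes cont: "continuous_on UNIV f" and K: "compact K" and A: "compact A"
    and tangent: "\<And>s. s \<in> A \<Longrightarrow> f s = c \<Longrightarrow> \<exists>u. (f has_vector_derivative u) (at s) \<and> (\<forall>w\<in>K. det2 w u \<noteq> 0)"
  shows "\<forall>\<^sub>F \<epsilon> in at_right 0. \<forall>w\<in>K. c + \<epsilon> *\<^sub>R w \<notin> f ` A"
proof -
  obtain B where "B > 0" and B: "\<And>w. w \<in> K \<Longrightarrow> cmod w \<le> B"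
    using compact_imp_bounded[OF K] unfolding bounded_pos by blast
  have "\<exists>U. open U \<and> s \<in> U \<and> (\<forall>\<^sub>F \<epsilon> in at_right 0. \<forall>w\<in>K. c + \<epsilon> *\<^sub>R w \<notin> f ` U)" if "s \<in> A" for s
  proof (cases "f s = c")
    case True
    with tangent[OF that] obtain u where u: "(f has_vector_derivative u) (at s)" "\<And>w. w \<in> K \<Longrightarrow> det2 w u \<noteq> 0"
      by blast
    obtain \<eta> where \<eta>: "\<eta> > 0" "\<And>r \<epsilon> w. \<bar>r - s\<bar> < \<eta> \<Longrightarrow> \<epsilon> > 0 \<Longrightarrow> w \<in> K \<Longrightarrow> f r \<noteq> f s + \<epsilon> *\<^sub>R w"
      using curve_leaves_cone[OF u(1) K u(2)] by blast
    have "c + \<epsilon> *\<^sub>R w \<notin> f ` ball s \<eta>" if "\<epsilon> > 0" "w \<in> K" for \<epsilon> w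
      using \<eta>(2)[OF _ that] True by (fastforce simp: dist_real_def abs_minus_commute)
    then have "\<forall>\<^sub>F \<epsilon> in at_right 0. \<forall>w\<in>K. c + \<epsilon> *\<^sub>R w \<notin> f ` ball s \<eta>"
      by (intro eventually_mono[OF eventually_at_right_less[of 0]]) blast
    then show ?thesis using \<open>\<eta> > 0\<close> by (intro exI[of _ "ball s \<eta>"]) auto
  next
    case False
    define \<rho> where "\<rho> = dist (f s) c / 2"
    have "\<rho> > 0" using False by (simp add: \<rho>_def)
    have "\<forall>\<^sub>F \<epsilon> in at_right 0. \<epsilon> < \<rho> / B"
      using \<open>\<rho> > 0\<close> \<open>B > 0\<close> by (intro eventually_at_rightI[of 0 "\<rho> / B"]) auto
    then have "\<forall>\<^sub>F \<epsilon> in at_right 0. \<forall>w\<in>K. c + \<epsilon> *\<^sub>R w \<notin> f ` (f -` ball (f s) \<rho>)"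
      using eventually_at_right_less[of 0]
    proof eventually_elim
      case (elim \<epsilon>)
      show ?case
      proof
        fix w assume "w \<in> K"
        have "dist (c + \<epsilon> *\<^sub>R w) c \<le> \<epsilon> * B" using B[OF \<open>w \<in> K\<close>] elim by (simp add: dist_norm)
        also have "\<dots> < \<rho>" using elim \<open>B > 0\<close> by (simp add: pos_less_divide_eq)
        finally have "dist (f s) (c + \<epsilon> *\<^sub>R w) > \<rho>"
          using dist_triangle[of "f s" c "c + \<epsilon> *\<^sub>R w"] unfolding \<rho>_def by linarith
        then show "c + \<epsilon> *\<^sub>R w \<notin> f ` (f -` ball (f s) \<rho>)" by auto
      qed
    qed
    then show ?thesis
      using \<open>\<rho> > 0\<close> cont by (intro exI[of _ "f -` ball (f s) \<rho>"]) (auto intro: open_vimage)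
  qed
  then have "\<forall>s\<in>A. \<exists>U. open U \<and> s \<in> U \<and> (\<forall>\<^sub>F \<epsilon> in at_right 0. \<forall>w\<in>K. c + \<epsilon> *\<^sub>R w \<notin> f ` U)" ..
  from bchoice[OF this]
  obtain U where U: "\<forall>s\<in>A. open (U s) \<and> s \<in> U s \<and> (\<forall>\<^sub>F \<epsilon> in at_right 0. \<forall>w\<in>K. c + \<epsilon> *\<^sub>R w \<notin> f ` U s)" ..
  obtain T where T: "T \<subseteq> A" "finite T" "A \<subseteq> (\<Union>s\<in>T. U s)"
    by (rule compactE_image[OF A, of A U]) (use U in auto)
  have "\<forall>\<^sub>F \<epsilon> in at_right 0. \<forall>s\<in>T. \<forall>w\<in>K. c + \<epsilon> *\<^sub>R w \<notin> f ` U s"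
    using T(1,2) U by (intro eventually_ball_finite) auto
  then show ?thesis by eventually_elim (use T(3) in blast)
qed

lemma transverse_range:
  assumes "transverse_diagram D"
  shows "range (curve D) = path_image (curve D)"
proof -
  have "curve D s \<in> curve D ` {0..1}" for s
  proof -
    obtain q where "q - s \<in> \<int>" "0 \<le> q" "q < 0 + 1" using exists_shift_into_period .
    then show ?thesis using transverse_periodic[OF assms, of q s]
      by (intro image_eqI[of _ _ q]) auto
  qed
  then show ?thesis by (auto simp: path_image_def)
qed

lemma transverse_loop:
  assumes "transverse_diagram D"
  shows "path (curve D)" "pathfinish (curve D) = pathstart (curve D)"
  using transverse_continuous[OF assms] transverse_periodic[OF assms, of 1 0]
  by (auto simp: path_def pathfinish_def pathstart_def)

lemma region_index_eq_winding_number: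
  assumes D: "transverse_diagram D" and "R \<in> regions D" "z \<in> R"
  shows "region_index D R = Re (winding_number (curve D) z)"
proof -
  have "(SOME z. z \<in> R) \<in> R" using assms(3) by (rule someI)
  moreover have "connected R" "R \<inter> path_image (curve D) = {}"
    using assms(2) in_components_subset[of R] by (auto simp: regions_def in_components_connected transverse_range[OF D])
  ultimately show ?thesis
    unfolding region_index_def using winding_number_eq[OF transverse_loop[OF D]] assms(3) by metis
qed

text \<open>
  The truncated cone \<open>C\<close> over \<open>K\<close> is connected and avoids the curve, so that it lies in a single region,
  which is the one towards \<open>w0\<close>.
\<close>

lemma corner_index_eq_winding_number:
  assumes D: "transverse_diagram D" and c: "c \<in> crossings D"
    and K: "compact K" "connected K" "w0 \<in> K"
    and det: "\<And>w. w \<in> K \<Longrightarrow> det2 w (over_tangent D c) \<noteq> 0 \<and> det2 w (under_tangent D c) \<noteq> 0"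
  shows "\<forall>\<^sub>F \<epsilon> in at_right 0. \<forall>w\<in>K. c + \<epsilon> *\<^sub>R w \<notin> range (curve D) \<and>
    Re (winding_number (curve D) (c + \<epsilon> *\<^sub>R w)) = region_index D (region_towards D c w0)"
proof -
  obtain s t where st: "s - t \<notin> \<int>" "curve D s = c" "curve D t = c" "s \<in> over D" "t \<notin> over D"
    using crossing_parameters[OF D c] .
  note tan = crossing_tangents[OF D st]
  have "\<forall>\<^sub>F \<epsilon> in at_right 0. \<forall>w\<in>K. c + \<epsilon> *\<^sub>R w \<notin> curve D ` {0..1}"
  proof (rule compact_curve_avoids_cone[OF transverse_continuous[OF D] K(1) compact_Icc])
    fix r assume r: "curve D r = c"
    then have "r - s \<in> \<int> \<or> r - t \<in> \<int>" using crossing_two_strands[OF D st(1), of r] st by simp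
    then have "vector_derivative (curve D) (at r) \<in> {over_tangent D c, under_tangent D c}"
      using transverse_derivative_periodic[OF D] tan by fastforce
    moreover have "(curve D has_vector_derivative vector_derivative (curve D) (at r)) (at r)"
    proof (cases "r - t \<in> \<int>")
      case True
      then have "r - s \<notin> \<int>" using st(1) Ints_diff_trans Ints_diff_sym by meson
      then show ?thesis using transverse_differentiable[OF D, of r s] st r by simp
    qed (use transverse_differentiable[OF D, of r t] st r in simp)
    ultimately show "\<exists>u. (curve D has_vector_derivative u) (at r) \<and> (\<forall>w\<in>K. det2 w u \<noteq> 0)"
      using det by auto
  qed
  then obtain d where "d > 0" and d: "\<And>\<epsilon> w. 0 < \<epsilon> \<Longrightarrow> \<epsilon> < d \<Longrightarrow> w \<in> K \<Longrightarrow> c + \<epsilon> *\<^sub>R w \<notin> range (curve D)"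
    unfolding eventually_at_right_field transverse_range[OF D] path_image_def by auto
  define C where "C = (\<lambda>(\<epsilon>, w). c + \<epsilon> *\<^sub>R w) ` ({0<..<d} \<times> K)"
  have "connected C"
    unfolding C_def case_prod_beta using K(2)
    by (intro connected_continuous_image continuous_intros connected_Times) auto
  have CI: "c + \<epsilon> *\<^sub>R w \<in> C" if "0 < \<epsilon>" "\<epsilon> < d" "w \<in> K" for \<epsilon> w
    using that by (force simp: C_def)
  have C: "C \<subseteq> - range (curve D)" using d unfolding C_def by fastforce
  have "c + (d / 2) *\<^sub>R w0 \<in> C" using CI \<open>d > 0\<close> K(3) by simp
  then obtain R where R: "R \<in> regions D" "C \<subseteq> R"
    using exists_component_superset[OF C] \<open>connected C\<close> C unfolding regions_def by blast
  have "region_towards D c w0 = R"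
    unfolding region_towards_def
  proof (rule the_equality)
    have ev: "\<forall>\<^sub>F \<epsilon> in at_right 0. c + \<epsilon> *\<^sub>R w0 \<in> R"
      using CI R(2) K(3) \<open>d > 0\<close> by (intro eventually_at_rightI[of 0 d]) auto
    with R show "R \<in> regions D \<and> (\<forall>\<^sub>F \<epsilon> in at_right 0. c + \<epsilon> *\<^sub>R w0 \<in> R)" by simp
    fix R' assume R': "R' \<in> regions D \<and> (\<forall>\<^sub>F \<epsilon> in at_right 0. c + \<epsilon> *\<^sub>R w0 \<in> R')"
    then have "\<forall>\<^sub>F \<epsilon> in at_right 0. c + \<epsilon> *\<^sub>R w0 \<in> R' \<and> c + \<epsilon> *\<^sub>R w0 \<in> R"
      using ev by (simp add: eventually_conj)
    then have "R \<inter> R' \<noteq> {}"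
      using eventually_happens'[OF trivial_limit_at_right_real] by blast
    then show "R' = R" using R' R components_eq unfolding regions_def by blast
  qed
  then have "Re (winding_number (curve D) (c + \<epsilon> *\<^sub>R w)) = region_index D (region_towards D c w0)"
    if "0 < \<epsilon>" "\<epsilon> < d" "w \<in> K" for \<epsilon> w
    using region_index_eq_winding_number[OF D R(1)] CI[OF that] R(2) by auto
  then show ?thesis
    using d \<open>d > 0\<close> by (intro eventually_at_rightI[of 0 d]) auto
qed

section \<open>Diffeomorphisms preserve the index\<close>

lemma right_difference_quotient:
  fixes f :: "real \<Rightarrow> complex"
  assumes "(f has_vector_derivative p) (at r)"
  shows "((\<lambda>t. (f t - f r) /\<^sub>R (t - r)) \<longlongrightarrow> p) (at_right r)"
proof -
  have quotient: "Re ((f t - f r) /\<^sub>R (t - r)) = (Re (f t) - Re (f r)) / (t - r)"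
    "Im ((f t - f r) /\<^sub>R (t - r)) = (Im (f t) - Im (f r)) / (t - r)" for t
    by (simp_all add: divide_inverse_commute)
  show ?thesis
    using has_vector_derivative_at_within[OF assms, of "{r<..}"]
    unfolding tendsto_complex_iff quotient has_vector_derivative_complex_iff has_field_derivative_iff .
qed

text \<open>
  For a direction \<open>w\<close> into a corner at \<open>c\<close>, the points \<open>h (c + \<epsilon> w)\<close> do not lie on the ray from \<open>h c\<close> in
  the direction \<open>h' c w\<close>, but they are of the form \<open>h c + \<epsilon> x\<close> with \<open>x\<close> in a given ball around \<open>h' c w\<close>
  as soon as \<open>\<epsilon>\<close> is small. If the ball contains no direction tangent to the image curve,
  all these points have the same winding number.
\<close>

lemma SCI_move:
  assumes D: "transverse_diagram D" and h: "plane_diffeo h"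
  shows "transverse_diagram (move h D)" and "SCI (move h D) = SCI D"
proof -
  obtain h' :: "complex \<Rightarrow> complex \<Rightarrow>\<^sub>L complex"
    where deriv: "\<And>z. (h has_derivative blinfun_apply (h' z)) (at z)"
      and pos: "\<And>z. det2 (blinfun_apply (h' z) 1) (blinfun_apply (h' z) \<i>) > 0"
    using h unfolding plane_diffeo_def by blast
  have inj: "inj h" using h by (simp add: plane_diffeo_def bij_is_inj)
  have conth: "continuous_on UNIV h"
    using deriv by (meson continuous_at_imp_continuous_on has_derivative_continuous)
  have lin: "linear (blinfun_apply (h' z))" for z
    by (rule bounded_linear.linear[OF blinfun.bounded_linear_right])
  note det = linear_det2[OF lin]
  have chain: "(h \<circ> curve D has_vector_derivative h' (curve D t) u) (at t)"
    if "(curve D has_vector_derivative u) (at t)" for t u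
    using vector_derivative_diff_chain_within[of "curve D" u t UNIV h] that deriv
    by (simp add: has_derivative_at_withinI)
  have meet: "(h \<circ> curve D) s = (h \<circ> curve D) t \<longleftrightarrow> curve D s = curve D t" for s t
    using inj by (simp add: inj_eq)
  have tangent: "vector_derivative (h \<circ> curve D) (at s) = h' (curve D s) (vector_derivative (curve D) (at s))"
    if "s - t \<notin> \<int>" "curve D s = curve D t" for s t
    by (rule vector_derivative_at[OF chain[OF transverse_differentiable[OF D that]]])
  show T: "transverse_diagram (move h D)"
    unfolding transverse_diagram_def
  proof (intro conjI allI impI)
    fix s t
    assume "s - t \<notin> \<int> \<and> curve (move h D) s = curve (move h D) t"
    then have st: "s - t \<notin> \<int>" "curve D s = curve D t" using meet by (auto simp: move_def)
    then have ts: "t - s \<notin> \<int>" "curve D t = curve D s" using Ints_diff_sym by auto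
    show "curve (move h D) differentiable at s" "curve (move h D) differentiable at t"
      using chain[OF transverse_differentiable[OF D st]] chain[OF transverse_differentiable[OF D ts]]
      by (auto simp: move_def differentiableI_vector)
    have "det2 (h' (curve D t) (vector_derivative (curve D) (at s))) (h' (curve D t) (vector_derivative (curve D) (at t))) \<noteq> 0"
      unfolding det[of _ "vector_derivative (curve D) (at s)"]
      using pos[of "curve D t"] transverse_det[OF D st] by simp
    then show "det2 (vector_derivative (curve (move h D)) (at s)) (vector_derivative (curve (move h D)) (at t)) \<noteq> 0"
      using st tangent[OF st] tangent[OF ts] by (simp add: move_def)
    show "s \<in> over (move h D) \<longleftrightarrow> t \<notin> over (move h D)"
      using transverse_over_iff[OF D st] by (simp add: move_def)
  qed (use D in \<open>auto simp: transverse_diagram_def move_def intro!: continuous_on_compose2[OF conth]\<close>)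
  have crossings: "crossings (move h D) = h ` crossings D"
  proof
    show "crossings (move h D) \<subseteq> h ` crossings D"
    proof
      fix c assume "c \<in> crossings (move h D)"
      then obtain s t where st: "s - t \<notin> \<int>" "(h \<circ> curve D) s = c" "(h \<circ> curve D) t = c"
        by (auto simp: crossings_def move_def)
      then have "curve D s = curve D t" using meet[of s t] by simp
      with st(1) have "curve D s \<in> crossings D"
        unfolding crossings_def by (intro CollectI exI[of _ s] exI[of _ t]) simp
      with st(2) show "c \<in> h ` crossings D" by auto
    qed
    show "h ` crossings D \<subseteq> crossings (move h D)"
    proof clarify
      fix c assume "c \<in> crossings D"
      then obtain s t where "s - t \<notin> \<int>" "curve D s = c" "curve D t = c"
        by (auto simp: crossings_def)
      then show "h c \<in> crossings (move h D)"
        unfolding crossings_def move_def by (intro CollectI exI[of _ s] exI[of _ t]) simp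
    qed
  qed
  have contribution: "crossing_sign (move h D) (h c) * crossing_index (move h D) (h c) = crossing_sign D c * crossing_index D c"
    if c: "c \<in> crossings D" for c
  proof -
    obtain s t where st: "s - t \<notin> \<int>" "curve D s = c" "curve D t = c" "s \<in> over D" "t \<notin> over D"
      using crossing_parameters[OF D c] .
    have ts: "t - s \<notin> \<int>" using st(1) Ints_diff_sym by auto
    define u v where "u = over_tangent D c" and "v = under_tangent D c"
    note tan = crossing_tangents[OF D st]
    have uv: "det2 u v \<noteq> 0"
      using transverse_det[OF D st(1)] st tan by (simp add: u_def v_def)
    have tan': "over_tangent (move h D) (h c) = h' c u" "under_tangent (move h D) (h c) = h' c v"
      using crossing_tangents[OF T, of s t "h c"] st tan tangent[OF st(1)] tangent[OF ts]
      by (simp_all add: move_def u_def v_def)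
    have sgn: "crossing_sign (move h D) (h c) = crossing_sign D c"
      unfolding crossing_sign_def tan' det[of c u v] using pos[of c]
      by (simp add: sgn_mult u_def v_def)
    have corner: "region_index (move h D) (region_towards (move h D) (h c) (h' c w)) = region_index D (region_towards D c w)"
      if wu: "det2 w u \<noteq> 0" and wv: "det2 w v \<noteq> 0" for w
    proof -
      define W where "W = {x. det2 x (h' c u) \<noteq> 0 \<and> det2 x (h' c v) \<noteq> 0}"
      have "open W" unfolding W_def
        by (intro open_Collect_conj open_Collect_neq continuous_intros)
      moreover have "h' c w \<in> W"
        using wu wv pos[of c] by (simp add: W_def det[of c w])
      ultimately obtain e where "e > 0" and e: "cball (h' c w) e \<subseteq> W"
        using open_contains_cball by blast
      have 1: "\<forall>\<^sub>F \<epsilon> in at_right 0. \<forall>x\<in>cball (h' c w) e. h c + \<epsilon> *\<^sub>R x \<notin> range (curve (move h D)) \<and>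
          Re (winding_number (curve (move h D)) (h c + \<epsilon> *\<^sub>R x)) =
          region_index (move h D) (region_towards (move h D) (h c) (h' c w))"
        by (rule corner_index_eq_winding_number[OF T])
           (use c \<open>e > 0\<close> e in \<open>auto simp: crossings tan' W_def\<close>)
      have 2: "\<forall>\<^sub>F \<epsilon> in at_right 0. \<forall>x\<in>{w}. c + \<epsilon> *\<^sub>R x \<notin> range (curve D) \<and>
          Re (winding_number (curve D) (c + \<epsilon> *\<^sub>R x)) = region_index D (region_towards D c w)"
        by (rule corner_index_eq_winding_number[OF D c])
           (use wu wv in \<open>auto simp: u_def v_def\<close>)
      have "((\<lambda>\<epsilon>. c + \<epsilon> *\<^sub>R w) has_vector_derivative w) (at 0)"
        by (auto simp: has_vector_derivative_def intro!: derivative_eq_intros)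
      then have "((\<lambda>\<epsilon>. h (c + \<epsilon> *\<^sub>R w)) has_vector_derivative h' c w) (at 0)"
        using vector_derivative_diff_chain_within[of "\<lambda>\<epsilon>. c + \<epsilon> *\<^sub>R w" w 0 UNIV h "blinfun_apply (h' c)"] deriv[of c]
        by (simp add: o_def has_derivative_at_withinI)
      from right_difference_quotient[OF this]
      have "((\<lambda>\<epsilon>. (h (c + \<epsilon> *\<^sub>R w) - h c) /\<^sub>R \<epsilon>) \<longlongrightarrow> h' c w) (at_right 0)"
        by simp
      then have 3: "\<forall>\<^sub>F \<epsilon> in at_right 0. dist ((h (c + \<epsilon> *\<^sub>R w) - h c) /\<^sub>R \<epsilon>) (h' c w) < e"
        using \<open>e > 0\<close> by (rule tendstoD)
      have "\<forall>\<^sub>F \<epsilon> in at_right (0::real). region_index (move h D) (region_towards (move h D) (h c) (h' c w)) =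
          region_index D (region_towards D c w)"
        using 1 2 3 eventually_at_right_less[of 0]
      proof eventually_elim
        case (elim \<epsilon>)
        define x where "x = (h (c + \<epsilon> *\<^sub>R w) - h c) /\<^sub>R \<epsilon>"
        have x: "h c + \<epsilon> *\<^sub>R x = h (c + \<epsilon> *\<^sub>R w)" using elim(4) by (simp add: x_def)
        have "x \<in> cball (h' c w) e" using elim(3) by (simp add: x_def dist_commute less_imp_le)
        then have "region_index (move h D) (region_towards (move h D) (h c) (h' c w)) =
            Re (winding_number (h \<circ> curve D) (h (c + \<epsilon> *\<^sub>R w)))"
          using elim(1) x by (metis move_def diagram.select_convs(1) diagram.surjective diagram.update_convs(1))
        also have "\<dots> = Re (winding_number (curve D) (c + \<epsilon> *\<^sub>R w))"
          using winding_number_diffeo_image[OF conth inj deriv pos transverse_loop[OF D]] elim(2)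
          by (simp add: transverse_range[OF D])
        finally show ?case using elim(2) by simp
      qed
      then show ?thesis by (simp add: eventually_const_iff)
    qed
    have "crossing_index (move h D) (h c) = crossing_index D c"
      unfolding crossing_index_def tan' u_def[symmetric] v_def[symmetric]
    proof (intro arg_cong2[where f = "(/)"] refl sum.cong)
      fix i j :: real assume "i \<in> {-1, 1}" "j \<in> {-1, 1}"
      then show "region_index (move h D) (region_towards (move h D) (h c) (i *\<^sub>R h' c u + j *\<^sub>R h' c v)) =
          region_index D (region_towards D c (i *\<^sub>R u + j *\<^sub>R v))"
        using corner[of "i *\<^sub>R u + j *\<^sub>R v"] uv
        by (auto simp: det2_simps det2_commute[of v u] blinfun.add_right blinfun.scaleR_right simp del: scaleR_minus1_left)
    qed
    with sgn show ?thesis by simp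
  qed
  show "SCI (move h D) = SCI D"
    unfolding SCI_def crossings
    by (subst sum.reindex) (use inj contribution in \<open>auto intro: inj_on_subset simp: o_def\<close>)
qed

section \<open>Diagrams joined by a band\<close>

lemma right_tangent_direction:
  fixes f :: "real \<Rightarrow> complex"
  assumes "(f has_vector_derivative p) (at r)" "p \<noteq> 0"
  shows "((\<lambda>t. sgn (f t - f r)) \<longlongrightarrow> sgn p) (at_right r)"
proof -
  have "((\<lambda>t. (f t - f r) /\<^sub>R (t - r)) \<longlongrightarrow> p) (at_right r)"
    by (rule right_difference_quotient) fact
  then have "((\<lambda>t. sgn ((f t - f r) /\<^sub>R (t - r))) \<longlongrightarrow> sgn p) (at_right r)"
    by (rule tendsto_sgn) fact
  then show ?thesis
  proof (rule tendsto_cong[THEN iffD1, rotated])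
    show "\<forall>\<^sub>F t in at_right r. sgn ((f t - f r) /\<^sub>R (t - r)) = sgn (f t - f r)"
      using eventually_at_right_less[of r] by eventually_elim (simp add: sgn_scaleR)
  qed
qed

text \<open>
  The reparametrization \<open>\<phi>\<close> need not be differentiable, but the directions of the secants
  of \<open>f\<close> to the right of \<open>r\<close> are those of the secants of \<open>g\<close> to the right of \<open>\<phi> r\<close>, and they
  converge to the directions of the tangents.
\<close>

lemma reparametrized_tangents:
  fixes f g :: "real \<Rightarrow> complex"
  assumes cont: "continuous_on {x..y} \<phi>" and mono: "strict_mono_on {x..y} \<phi>"
    and eq: "\<And>t. t \<in> {x..y} \<Longrightarrow> f t = g (\<phi> t)" and r: "x < r" "r < y"
    and p: "(f has_vector_derivative p) (at r)" "p \<noteq> 0"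
    and q: "(g has_vector_derivative q) (at (\<phi> r))" "q \<noteq> 0"
  obtains \<alpha> where "\<alpha> > 0" "p = \<alpha> *\<^sub>R q"
proof -
  have near: "\<forall>\<^sub>F t in at_right r. t \<in> {r<..<y}"
    using r by (intro eventually_at_rightI[of r y]) auto
  have "\<phi> \<midarrow>r\<rightarrow> \<phi> r"
    using continuous_on_interior[OF cont, of r] r by (simp add: continuous_within)
  then have "(\<phi> \<longlongrightarrow> \<phi> r) (at_right r)"
    by (rule tendsto_mono[rotated]) (simp add: at_within_le_at)
  then have "filterlim \<phi> (at_right (\<phi> r)) (at_right r)"
    using near strict_mono_onD[OF mono] r
    by (intro filterlim_at_withinI) (auto elim!: eventually_mono)
  from filterlim_compose[OF right_tangent_direction[OF q] this]
  have "((\<lambda>t. sgn (g (\<phi> t) - g (\<phi> r))) \<longlongrightarrow> sgn q) (at_right r)" .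
  moreover have "\<forall>\<^sub>F t in at_right r. sgn (g (\<phi> t) - g (\<phi> r)) = sgn (f t - f r)"
    using near by eventually_elim (use eq r in simp)
  ultimately have "((\<lambda>t. sgn (f t - f r)) \<longlongrightarrow> sgn q) (at_right r)"
    by (simp cong: tendsto_cong)
  with right_tangent_direction[OF p] have "sgn p = sgn q"
    using tendsto_unique trivial_limit_at_right_real by blast
  then have "p = (cmod p / cmod q) *\<^sub>R q"
    by (metis (no_types) sgn_div_norm scaleR_scaleR divide_inverse norm_sgn p(2) q(2) scaleR_one right_inverse norm_eq_zero)
  with that p(2) q(2) show ?thesis by (meson divide_pos_pos zero_less_norm_iff)
qed

text \<open>
  The data of a \<^const>\<open>band_sum\<close>. Fixing them makes \<open>D\<close> and \<open>E\<close> interchangeable (\<open>swap\<close> below), so that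
  most facts are stated only for \<open>D\<close>.
\<close>

locale diagram_band =
  fixes D E F :: diagram and n :: complex and k :: real and \<beta> :: "real \<times> real \<Rightarrow> complex"
    and a b c d t0 t1 t2 t3 :: real
  assumes D: "transverse_diagram D" and E: "transverse_diagram E" and F: "transverse_diagram F"
    and halfD: "range (curve D) \<subseteq> {z. n \<bullet> z < k}" and halfE: "range (curve E) \<subseteq> {z. n \<bullet> z > k}"
    and \<beta>_cont: "continuous_on ({0..1} \<times> {0..1}) \<beta>" and \<beta>_inj: "inj_on \<beta> ({0..1} \<times> {0..1})"
    and ab: "a < b" "b < a + 1" "\<And>t. t \<in> {a..b} \<Longrightarrow> curve D t \<notin> crossings D"
    and cd: "c < d" "d < c + 1" "\<And>t. t \<in> {c..d} \<Longrightarrow> curve E t \<notin> crossings E"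
    and left: "\<And>t. t \<in> {0..1} \<Longrightarrow> \<beta> (0, t) = curve D (a + t * (b - a))"
    and right: "\<And>t. t \<in> {0..1} \<Longrightarrow> \<beta> (1, t) = curve E (d - t * (d - c))"
    and inner: "\<beta> ` ({0<..<1} \<times> {0..1}) \<subseteq> outside (range (curve D) \<union> range (curve E))"
    and times: "t0 < t1" "t1 < t2" "t2 < t3" "t3 < t0 + 1"
    and runD: "runs_along (strands F) t0 t1 (strands D) b (a + 1)"
    and runB: "runs_along (curve F) t1 t2 (\<lambda>s. \<beta> (s, 0)) 0 1"
    and runE: "runs_along (strands F) t2 t3 (strands E) d (c + 1)"
    and runT: "runs_along (curve F) t3 (t0 + 1) (\<lambda>s. \<beta> (1 - s, 1)) 0 1"
begin

text \<open>Turning the square by a half turn exchanges its left and right and its bottom and top sides.\<close>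

lemma swap: "diagram_band E D F (- n) (- k) (\<lambda>(s, t). \<beta> (1 - s, 1 - t)) c d a b t2 t3 (t0 + 1) (t1 + 1)"
proof
  show "continuous_on ({0..1} \<times> {0..1}) (\<lambda>(s, t). \<beta> (1 - s, 1 - t))"
    unfolding case_prod_beta
    by (intro continuous_on_compose2[OF \<beta>_cont] continuous_intros) auto
  show "inj_on (\<lambda>(s, t). \<beta> (1 - s, 1 - t)) ({0..1} \<times> {0..1})"
  proof (rule inj_onI, clarify)
    fix s t s' t' :: real
    assume "s \<in> {0..1}" "t \<in> {0..1}" "s' \<in> {0..1}" "t' \<in> {0..1}" "\<beta> (1 - s, 1 - t) = \<beta> (1 - s', 1 - t')"
    then have "(1 - s, 1 - t) = (1 - s', 1 - t')" by (intro inj_onD[OF \<beta>_inj]) auto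
    then show "s = s' \<and> t = t'" by simp
  qed
  show "(case (0, t) of (s, t) \<Rightarrow> \<beta> (1 - s, 1 - t)) = curve E (c + t * (d - c))" if "t \<in> {0..1}" for t
    using right[of "1 - t"] that by (simp add: algebra_simps)
  show "(case (1, t) of (s, t) \<Rightarrow> \<beta> (1 - s, 1 - t)) = curve D (b - t * (b - a))" if "t \<in> {0..1}" for t
    using left[of "1 - t"] that by (simp add: algebra_simps)
  have "\<beta> (1 - s, 1 - t) \<in> outside (range (curve D) \<union> range (curve E))"
    if "s \<in> {0<..<1}" "t \<in> {0..1}" for s t
    using inner that by (force simp: image_subset_iff)
  then show "(\<lambda>(s, t). \<beta> (1 - s, 1 - t)) ` ({0<..<1} \<times> {0..1}) \<subseteq> outside (range (curve E) \<union> range (curve D))"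
    by (auto simp: Un_commute)
  obtain \<phi> where \<phi>: "continuous_on {t0..t1} \<phi>" "strict_mono_on {t0..t1} \<phi>" "\<phi> t0 = b" "\<phi> t1 = a + 1"
      "\<And>t. t \<in> {t0..t1} \<Longrightarrow> strands F t = strands D (\<phi> t)"
    using runD unfolding runs_along_def by blast
  have per: "strands F t = strands F (t - 1)" for t
    using transverse_periodic[OF F, of t "t - 1"] transverse_over_periodic[OF F, of t "t - 1"]
    by (simp add: strands_def)
  show "runs_along (strands F) (t0 + 1) (t1 + 1) (strands D) b (a + 1)"
    unfolding runs_along_def
  proof (intro exI[of _ "\<lambda>t. \<phi> (t - 1)"] conjI)
    show "continuous_on {t0 + 1..t1 + 1} (\<lambda>t. \<phi> (t - 1))"
      by (intro continuous_on_compose2[OF \<phi>(1)] continuous_intros) auto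
    show "strict_mono_on {t0 + 1..t1 + 1} (\<lambda>t. \<phi> (t - 1))"
      using \<phi>(2) by (auto simp: strict_mono_on_def)
    show "\<forall>t\<in>{t0 + 1..t1 + 1}. strands F t = strands D (\<phi> (t - 1))"
    proof
      fix t assume "t \<in> {t0 + 1..t1 + 1}"
      then have "strands F (t - 1) = strands D (\<phi> (t - 1))" by (intro \<phi>(5)) auto
      then show "strands F t = strands D (\<phi> (t - 1))" using per[of t] by simp
    qed
  qed (use \<phi> in auto)
  obtain \<psi> where \<psi>: "continuous_on {t1..t2} \<psi>" "strict_mono_on {t1..t2} \<psi>" "\<psi> t1 = 0" "\<psi> t2 = 1"
      "\<And>t. t \<in> {t1..t2} \<Longrightarrow> curve F t = \<beta> (\<psi> t, 0)"
    using runB unfolding runs_along_def by blast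
  show "runs_along (curve F) (t1 + 1) (t2 + 1) (\<lambda>s. case (1 - s, 1) of (s, t) \<Rightarrow> \<beta> (1 - s, 1 - t)) 0 1"
    unfolding runs_along_def
  proof (intro exI[of _ "\<lambda>t. \<psi> (t - 1)"] conjI)
    show "continuous_on {t1 + 1..t2 + 1} (\<lambda>t. \<psi> (t - 1))"
      by (intro continuous_on_compose2[OF \<psi>(1)] continuous_intros) auto
    show "strict_mono_on {t1 + 1..t2 + 1} (\<lambda>t. \<psi> (t - 1))"
      using \<psi>(2) by (auto simp: strict_mono_on_def)
    show "\<forall>t\<in>{t1 + 1..t2 + 1}. curve F t = (case (1 - \<psi> (t - 1), 1) of (s, t) \<Rightarrow> \<beta> (1 - s, 1 - t))"
    proof
      fix t assume "t \<in> {t1 + 1..t2 + 1}"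
      then have "curve F (t - 1) = \<beta> (\<psi> (t - 1), 0)" by (intro \<psi>(5)) auto
      then show "curve F t = (case (1 - \<psi> (t - 1), 1) of (s, t) \<Rightarrow> \<beta> (1 - s, 1 - t))"
        using per[of t] by (simp add: strands_def)
    qed
  qed (use \<psi> in auto)
  show "range (curve E) \<subseteq> {z. - n \<bullet> z < - k}" "range (curve D) \<subseteq> {z. - n \<bullet> z > - k}"
    using halfD halfE by auto
  show "t0 + 1 < t1 + 1" "t1 + 1 < t2 + 1" using times by auto
  show "runs_along (curve F) t3 (t0 + 1) (\<lambda>s. case (s, 0) of (s, t) \<Rightarrow> \<beta> (1 - s, 1 - t)) 0 1"
    using runT by simp
qed (rule D E F ab cd times runE; assumption?)+

lemma runD_curve: "runs_along (curve F) t0 t1 (curve D) b (a + 1)"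
  using runD unfolding runs_along_def strands_def prod.inject by metis

lemma half_planes_disjoint: "range (curve D) \<inter> range (curve E) = {}"
proof -
  have "{z. n \<bullet> z < k} \<inter> {z. n \<bullet> z > k} = {}" by auto
  then show ?thesis using halfD halfE by blast
qed

lemma band_meets_D:
  assumes "s \<in> {0<..1}" "t \<in> {0..1}"
  shows "\<beta> (s, t) \<notin> range (curve D)"
proof (cases "s = 1")
  case True
  then have "\<beta> (s, t) \<in> range (curve E)" using right[OF assms(2)] by simp
  then show ?thesis using half_planes_disjoint by blast
next
  case False
  then have "\<beta> (s, t) \<in> outside (range (curve D) \<union> range (curve E))"
    using inner assms by (auto simp: image_subset_iff)
  then show ?thesis using outside_no_overlap by blast
qed

lemma crossing_not_on_band:
  assumes "p \<in> crossings D"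
  shows "p \<notin> \<beta> ` ({0..1} \<times> {0..1})"
proof
  assume "p \<in> \<beta> ` ({0..1} \<times> {0..1})"
  then obtain s t where st: "s \<in> {0..1}" "t \<in> {0..1}" "p = \<beta> (s, t)" by auto
  have "p \<in> range (curve D)" using assms by (auto simp: crossings_def)
  then have "s = 0" using band_meets_D[of s t] st by (cases "s = 0") auto
  then show False
    using left[OF st(2)] ab(3)[of "a + t * (b - a)"] affine_mem_interval[OF ab(1) st(2)] st assms
    by (simp add: algebra_simps)
qed

text \<open>
  The open bottom and top sides are treated together, as one injective map \<open>\<xi>\<close> into the square, so
  that the band being embedded excludes crossings of \<open>F\<close> within its boundary.
\<close>

lemma band_sides:
  obtains \<xi> where "inj_on \<xi> ({t1<..<t2} \<union> {t3<..<t0 + 1})"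
    "\<forall>t \<in> {t1<..<t2} \<union> {t3<..<t0 + 1}. \<xi> t \<in> {0<..<1} \<times> {0..1} \<and> curve F t = \<beta> (\<xi> t)"
proof -
  obtain \<phi> where \<phi>: "strict_mono_on {t1..t2} \<phi>" "\<phi> t1 = 0" "\<phi> t2 = 1"
      "\<And>t. t \<in> {t1..t2} \<Longrightarrow> curve F t = \<beta> (\<phi> t, 0)"
    using runB unfolding runs_along_def by blast
  obtain \<psi> where \<psi>: "strict_mono_on {t3..t0 + 1} \<psi>" "\<psi> t3 = 0" "\<psi> (t0 + 1) = 1"
      "\<And>t. t \<in> {t3..t0 + 1} \<Longrightarrow> curve F t = \<beta> (1 - \<psi> t, 1)"
    using runT unfolding runs_along_def by blast
  define \<xi> where "\<xi> t = (if t < t2 then (\<phi> t, 0 :: real) else (1 - \<psi> t, 1))" for t :: real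
  have \<xi>1: "\<xi> t = (\<phi> t, 0)" "\<phi> t \<in> {0<..<1}" if "t \<in> {t1<..<t2}" for t
    using that strict_mono_onD[OF \<phi>(1), of t1 t] strict_mono_onD[OF \<phi>(1), of t t2] \<phi>(2,3)
    by (auto simp: \<xi>_def)
  have \<xi>2: "\<xi> t = (1 - \<psi> t, 1)" "\<psi> t \<in> {0<..<1}" if "t \<in> {t3<..<t0 + 1}" for t
    using that strict_mono_onD[OF \<psi>(1), of t3 t] strict_mono_onD[OF \<psi>(1), of t "t0 + 1"] \<psi>(2,3) times
    by (auto simp: \<xi>_def)
  show thesis
  proof
    show "inj_on \<xi> ({t1<..<t2} \<union> {t3<..<t0 + 1})"
    proof (rule inj_onI)
      fix s t assume st: "s \<in> {t1<..<t2} \<union> {t3<..<t0 + 1}" "t \<in> {t1<..<t2} \<union> {t3<..<t0 + 1}" "\<xi> s = \<xi> t"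
      have "snd (\<xi> r) = 0 \<longleftrightarrow> r < t2" for r by (simp add: \<xi>_def)
      then have "s < t2 \<longleftrightarrow> t < t2" using st(3) by metis
      then consider "s \<in> {t1<..<t2}" "t \<in> {t1<..<t2}" | "s \<in> {t3<..<t0 + 1}" "t \<in> {t3<..<t0 + 1}"
        using st(1,2) times by force
      then show "s = t"
      proof cases
        case 1
        then show ?thesis
          using st(3) \<xi>1(1)[of s] \<xi>1(1)[of t] inj_onD[OF strict_mono_on_imp_inj_on[OF \<phi>(1)], of s t] by simp
      next
        case 2
        then show ?thesis
          using st(3) \<xi>2(1)[of s] \<xi>2(1)[of t] inj_onD[OF strict_mono_on_imp_inj_on[OF \<psi>(1)], of s t] by simp
      qed
    qed
    show "\<forall>t \<in> {t1<..<t2} \<union> {t3<..<t0 + 1}. \<xi> t \<in> {0<..<1} \<times> {0..1} \<and> curve F t = \<beta> (\<xi> t)"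
    proof
      fix t assume "t \<in> {t1<..<t2} \<union> {t3<..<t0 + 1}"
      then show "\<xi> t \<in> {0<..<1} \<times> {0..1} \<and> curve F t = \<beta> (\<xi> t)"
      proof
        assume "t \<in> {t1<..<t2}"
        then show ?thesis using \<xi>1[of t] \<phi>(4)[of t] by simp
      next
        assume "t \<in> {t3<..<t0 + 1}"
        then show ?thesis using \<xi>2[of t] \<psi>(4)[of t] by simp
      qed
    qed
  qed
qed

lemma F_on_D: "t \<in> {t0..t1} \<Longrightarrow> curve F t \<in> range (curve D)"
  using runD_curve unfolding runs_along_def by auto

lemma band_meets_E: "s \<in> {0..<1} \<Longrightarrow> t \<in> {0..1} \<Longrightarrow> \<beta> (s, t) \<notin> range (curve E)"
  using diagram_band.band_meets_D[OF swap, of "1 - s" "1 - t"] by simp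

lemma F_cases:
  assumes "t \<in> {t0..<t0 + 1}"
  obtains (D) "t \<in> {t0..t1}" "curve F t \<in> range (curve D)" "curve F t \<notin> range (curve E)"
    | (E) "t \<in> {t2..t3}" "curve F t \<in> range (curve E)" "curve F t \<notin> range (curve D)"
    | (band) "t \<in> {t1<..<t2} \<union> {t3<..<t0 + 1}" "curve F t \<in> \<beta> ` ({0<..<1} \<times> {0..1})"
        "curve F t \<notin> range (curve D)" "curve F t \<notin> range (curve E)"
proof -
  consider "t \<in> {t0..t1}" | "t \<in> {t2..t3}" | "t \<in> {t1<..<t2} \<union> {t3<..<t0 + 1}"
    using assms by force
  then show thesis
  proof cases
    case 1
    moreover from 1 have "curve F t \<in> range (curve D)" by (rule F_on_D)
    moreover from this have "curve F t \<notin> range (curve E)" using half_planes_disjoint by blast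
    ultimately show ?thesis by (rule D)
  next
    case 2
    moreover from 2 have "curve F t \<in> range (curve E)" by (rule diagram_band.F_on_D[OF swap])
    moreover from this have "curve F t \<notin> range (curve D)" using half_planes_disjoint by blast
    ultimately show ?thesis by (rule E)
  next
    case 3
    obtain \<xi> where "\<forall>t \<in> {t1<..<t2} \<union> {t3<..<t0 + 1}. \<xi> t \<in> {0<..<1} \<times> {0..1} \<and> curve F t = \<beta> (\<xi> t)"
      by (rule band_sides)
    from bspec[OF this 3] have \<xi>: "\<xi> t \<in> {0<..<1} \<times> {0..1}" "curve F t = \<beta> (\<xi> t)" by auto
    obtain x y where xy: "\<xi> t = (x, y)" "x \<in> {0<..<1}" "y \<in> {0..1}" using \<xi>(1) by blast
    have eq: "curve F t = \<beta> (x, y)" using \<xi>(2) xy by simp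
    show ?thesis
    proof (rule band[OF 3])
      show "curve F t \<in> \<beta> ` ({0<..<1} \<times> {0..1})" using eq xy by blast
      show "curve F t \<notin> range (curve D)" "curve F t \<notin> range (curve E)"
        unfolding eq using xy by (simp_all add: band_meets_D band_meets_E)
    qed
  qed
qed

text \<open>The strand runs over \<open>{b..a + 1}\<close> only, which is shorter than a period.\<close>

lemma crossing_of_D_strand:
  assumes st: "s \<in> {t0..t1}" "t \<in> {t0..t1}" "s \<noteq> t" and eq: "curve F s = curve F t"
  shows "curve F s \<in> crossings D"
proof -
  obtain \<phi> where \<phi>: "strict_mono_on {t0..t1} \<phi>" "\<phi> t0 = b" "\<phi> t1 = a + 1"
      "\<And>t. t \<in> {t0..t1} \<Longrightarrow> curve F t = curve D (\<phi> t)"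
    using runD_curve unfolding runs_along_def by blast
  have "\<phi> r \<in> {b..a + 1}" if "r \<in> {t0..t1}" for r
    using that mono_onD[OF strict_mono_on_imp_mono_on[OF \<phi>(1)], of t0 r]
      mono_onD[OF strict_mono_on_imp_mono_on[OF \<phi>(1)], of r t1] \<phi>(2,3) times(1) by auto
  from this[OF st(1)] this[OF st(2)] have "\<bar>\<phi> s - \<phi> t\<bar> < 1" using ab(1) by auto
  moreover have "\<phi> s \<noteq> \<phi> t"
    using inj_onD[OF strict_mono_on_imp_inj_on[OF \<phi>(1)], of s t] st by auto
  ultimately have "\<phi> s - \<phi> t \<notin> \<int>" by (intro nonzero_less_1_notin_Ints)
  then show ?thesis
    unfolding crossings_def using \<phi>(4) st eq by (intro CollectI exI[of _ "\<phi> s"] exI[of _ "\<phi> t"]) simp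
qed

text \<open>
  Two parameters of a crossing belong to the same one of the three parts of \<open>F\<close>, as these are disjoint in
  the plane, and the part on the band is embedded.
\<close>

lemma crossings_band_sum_subset: "crossings F \<subseteq> crossings D \<union> crossings E"
proof
  fix p assume "p \<in> crossings F"
  then obtain s' t' where st': "s' - t' \<notin> \<int>" "curve F s' = p" "curve F t' = p"
    by (auto simp: crossings_def)
  obtain s where s: "s - s' \<in> \<int>" "t0 \<le> s" "s < t0 + 1" using exists_shift_into_period .
  obtain t where t: "t - t' \<in> \<int>" "t0 \<le> t" "t < t0 + 1" using exists_shift_into_period .
  have st: "s \<noteq> t" using st'(1) s(1) t(1) Ints_diff_sym Ints_diff_trans by blast
  have ps: "curve F s = p" and pt: "curve F t = p"
    using transverse_periodic[OF F] s(1) t(1) st' by auto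
  have sI: "s \<in> {t0..<t0 + 1}" and tI: "t \<in> {t0..<t0 + 1}" using s t by auto
  show "p \<in> crossings D \<union> crossings E"
  proof (cases rule: F_cases[OF sI])
    case D: 1
    then have "t \<in> {t0..t1}" using ps pt by (cases rule: F_cases[OF tI]) auto
    then show ?thesis using crossing_of_D_strand[of s t] D st ps pt by simp
  next
    case E: 2
    then have "t \<in> {t2..t3}" using ps pt by (cases rule: F_cases[OF tI]) auto
    then show ?thesis using diagram_band.crossing_of_D_strand[OF swap, of s t] E st ps pt by simp
  next
    case band: 3
    then have tB: "t \<in> {t1<..<t2} \<union> {t3<..<t0 + 1}" using ps pt by (cases rule: F_cases[OF tI]) auto
    obtain \<xi> where inj: "inj_on \<xi> ({t1<..<t2} \<union> {t3<..<t0 + 1})"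
      and \<xi>: "\<forall>t \<in> {t1<..<t2} \<union> {t3<..<t0 + 1}. \<xi> t \<in> {0<..<1} \<times> {0..1} \<and> curve F t = \<beta> (\<xi> t)"
      by (rule band_sides)
    note \<xi>s = bspec[OF \<xi> band(1)] and \<xi>t = bspec[OF \<xi> tB]
    have "\<xi> s = \<xi> t"
    proof (rule inj_onD[OF \<beta>_inj])
      show "\<beta> (\<xi> s) = \<beta> (\<xi> t)" using \<xi>s \<xi>t ps pt by simp
      show "\<xi> s \<in> {0..1} \<times> {0..1}" "\<xi> t \<in> {0..1} \<times> {0..1}" using \<xi>s \<xi>t by (auto simp: mem_Times_iff)
    qed
    then have "s = t" by (rule inj_onD[OF inj _ band(1) tB])
    with st show ?thesis by simp
  qed
qed

text \<open>
  No crossing of \<open>D\<close> lies on the arc over \<open>{a..b}\<close>, so both of its strands are met by \<open>F\<close> in the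
  interior of \<open>{t0..t1}\<close>, where \<open>F\<close> reparametrizes \<open>D\<close>.
\<close>

lemma crossing_of_D_in_F:
  assumes p: "p \<in> crossings D"
  obtains \<alpha> \<gamma> where "\<alpha> > 0" "\<gamma> > 0" "p \<in> crossings F"
    "over_tangent F p = \<alpha> *\<^sub>R over_tangent D p" "under_tangent F p = \<gamma> *\<^sub>R under_tangent D p"
proof -
  obtain s t where st: "s - t \<notin> \<int>" "curve D s = p" "curve D t = p" "s \<in> over D" "t \<notin> over D"
    using crossing_parameters[OF D p] .
  obtain \<phi> where \<phi>: "continuous_on {t0..t1} \<phi>" "strict_mono_on {t0..t1} \<phi>" "\<phi> t0 = b" "\<phi> t1 = a + 1"
      "\<And>t. t \<in> {t0..t1} \<Longrightarrow> strands F t = strands D (\<phi> t)"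
    using runD unfolding runs_along_def by blast
  have \<phi>F: "curve F r = curve D (\<phi> r)" "r \<in> over F \<longleftrightarrow> \<phi> r \<in> over D" if "r \<in> {t0..t1}" for r
    using \<phi>(5)[OF that] by (auto simp: strands_def)
  have lift: "\<exists>r'\<in>{t0<..<t1}. \<phi> r' - r \<in> \<int>" if r: "curve D r = p" for r
  proof -
    obtain q where q: "q - r \<in> \<int>" "a \<le> q" "q < a + 1" using exists_shift_into_period .
    then have "curve D q = p" using transverse_periodic[OF D q(1)] r by simp
    then have "q \<notin> {a..b}" using ab(3) p by auto
    then have "b < q" using q(2) by auto
    then obtain r' where r': "t0 \<le> r'" "r' \<le> t1" "\<phi> r' = q"
      using IVT'[of \<phi> t0 q t1] \<phi>(1,3,4) q(3) times(1) by auto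
    moreover have "r' \<noteq> t0" "r' \<noteq> t1" using r' \<phi>(3,4) \<open>b < q\<close> q(3) by auto
    ultimately show ?thesis using q(1) by (intro bexI[of _ r']) auto
  qed
  obtain s' where s': "s' \<in> {t0<..<t1}" "\<phi> s' - s \<in> \<int>" using lift[OF st(2)] by blast
  obtain t' where t': "t' \<in> {t0<..<t1}" "\<phi> t' - t \<in> \<int>" using lift[OF st(3)] by blast
  have D': "\<phi> s' - \<phi> t' \<notin> \<int>" "curve D (\<phi> s') = p" "curve D (\<phi> t') = p" "\<phi> s' \<in> over D" "\<phi> t' \<notin> over D"
    using st s'(2) t'(2) transverse_periodic[OF D] transverse_over_periodic[OF D] Ints_diff_sym Ints_diff_trans
    by metis+
  have "s' \<noteq> t'" using D'(1) by auto
  moreover have "\<bar>s' - t'\<bar> < 1" using s'(1) t'(1) times by auto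
  ultimately have F': "s' - t' \<notin> \<int>" "curve F s' = p" "curve F t' = p" "s' \<in> over F" "t' \<notin> over F"
    using nonzero_less_1_notin_Ints[of s' t'] \<phi>F s'(1) t'(1) D' by auto
  have D'': "\<phi> t' - \<phi> s' \<notin> \<int>" and F'': "t' - s' \<notin> \<int>"
    using D'(1) F'(1) Ints_diff_sym by blast+
  have nonzero: "vector_derivative (curve G) (at r) \<noteq> 0"
    if "transverse_diagram G" "r - q \<notin> \<int>" "curve G r = curve G q" for G r q
    using transverse_det[OF that] by (auto simp: det2_simps)
  have proportional: "\<exists>\<alpha>>0. vector_derivative (curve F) (at r) = \<alpha> *\<^sub>R vector_derivative (curve D) (at (\<phi> r))"
    if "r \<in> {t0<..<t1}" "r - q \<notin> \<int>" "curve F r = curve F q" "\<phi> r - q' \<notin> \<int>" "curve D (\<phi> r) = curve D q'" for r q q'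
    using reparametrized_tangents[OF \<phi>(1,2) \<phi>F(1) _ _
        transverse_differentiable[OF F that(2,3)] nonzero[OF F that(2,3)]
        transverse_differentiable[OF D that(4,5)] nonzero[OF D that(4,5)]] that(1)
    by (metis greaterThanLessThan_iff)
  obtain \<alpha> where "\<alpha> > 0" "vector_derivative (curve F) (at s') = \<alpha> *\<^sub>R vector_derivative (curve D) (at (\<phi> s'))"
    using proportional[of s' t' "\<phi> t'"] s'(1) F' D' by auto
  moreover obtain \<gamma> where "\<gamma> > 0" "vector_derivative (curve F) (at t') = \<gamma> *\<^sub>R vector_derivative (curve D) (at (\<phi> t'))"
    using proportional[of t' s' "\<phi> s'"] t'(1) F' F'' D' D'' by auto
  moreover have "p \<in> crossings F" using F'(1-3) by (auto simp: crossings_def)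
  ultimately show thesis
    using that crossing_tangents[OF F F'] crossing_tangents[OF D D'] by metis
qed

text \<open>
  Going around the band gives \<open>bottom - c..d - top - a..b = 0\<close>, as the square is contractible. On adding
  this to \<open>D = a..b + b..a+1\<close> and \<open>E = c..d + d..c+1\<close>, the arcs \<open>a..b\<close> and \<open>c..d\<close> cancel and the four
  pieces of \<open>F\<close> are left.
\<close>

lemma winding_number_band_sum:
  assumes z: "z \<notin> range (curve D)" "z \<notin> range (curve E)" "z \<notin> \<beta> ` ({0..1} \<times> {0..1})"
  shows "winding_number (curve F) z = winding_number (curve D) z + winding_number (curve E) z"
proof -
  define w where "w f x y = winding_number (subpath x y f) z" for f x y
  have side: "continuous_on {0..1} (\<lambda>s. \<beta> (p s))" "z \<notin> (\<lambda>s. \<beta> (p s)) ` {0..1}"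
    if "continuous_on {0..1} p" "p ` {0..1} \<subseteq> {0..1} \<times> {0..1}" for p :: "real \<Rightarrow> real \<times> real"
    using continuous_on_compose2[OF \<beta>_cont that] z(3) that(2) by auto
  have runs: "w (curve F) t0 t1 = w (curve D) b (a + 1)"
    "w (curve F) t1 t2 = w (\<lambda>s. \<beta> (s, 0)) 0 1"
    "w (curve F) t2 t3 = w (curve E) d (c + 1)"
    "w (curve F) t3 (t0 + 1) = w (\<lambda>s. \<beta> (1 - s, 1)) 0 1"
  proof -
    show "w (curve F) t0 t1 = w (curve D) b (a + 1)"
      unfolding w_def using z(1)
      by (intro winding_number_runs_along[OF runD_curve times(1) transverse_continuous[OF D]]) auto
    show "w (curve F) t2 t3 = w (curve E) d (c + 1)"
      unfolding w_def using z(2)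
      by (intro winding_number_runs_along[OF diagram_band.runD_curve[OF swap] times(3) transverse_continuous[OF E]]) auto
    show "w (curve F) t1 t2 = w (\<lambda>s. \<beta> (s, 0)) 0 1"
      unfolding w_def
      by (intro winding_number_runs_along[OF runB times(2)] side continuous_intros) auto
    show "w (curve F) t3 (t0 + 1) = w (\<lambda>s. \<beta> (1 - s, 1)) 0 1"
      unfolding w_def
      by (intro winding_number_runs_along[OF runT times(4)] side continuous_intros) auto
  qed
  have zF: "z \<notin> range (curve F)"
  proof
    assume "z \<in> range (curve F)"
    then obtain s where "z = curve F s" by blast
    moreover obtain t where t: "t - s \<in> \<int>" "t0 \<le> t" "t < t0 + 1" using exists_shift_into_period .
    ultimately have zt: "curve F t = z" using transverse_periodic[OF F] by simp
    have "t \<in> {t0..<t0 + 1}" using t by simp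
    then show False
      using z zt by (cases rule: F_cases) auto
  qed
  have split: "w f x y + w f y u = w f x u"
    if "transverse_diagram G" "z \<notin> range (curve G)" "f = curve G" "x \<le> y" "y \<le> u" for f G x y u
    unfolding w_def that(3)
    by (rule winding_number_subpath_append) (use that transverse_continuous[OF that(1)] in auto)
  have period: "winding_number (curve G) z = w (curve G) x (x + 1)"
    if "transverse_diagram G" "z \<notin> range (curve G)" for G x
    unfolding w_def
    by (rule winding_number_one_period[symmetric])
      (use that transverse_continuous[OF that(1)] transverse_periodic[OF that(1)] in auto)
  define r where "r = linepath (0, 0) (1, 0) +++ linepath (1, 0) (1, 1) +++ linepath (1, 1) (0, 1) +++
    linepath (0, 1) (0::real, 0::real)"
  have boundary: "w (\<lambda>s. \<beta> (s, 0)) 0 1 - w (curve E) c d + w (\<lambda>s. \<beta> (1 - s, 1)) 0 1 - w (curve D) a b = 0"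
  proof -
    let ?Q = "{0..1} \<times> {0..1} :: (real \<times> real) set"
    have seg: "closed_segment x y \<subseteq> ?Q" if "x \<in> ?Q" "y \<in> ?Q" for x y
      using that by (intro closed_segment_subset convex_Times) auto
    have r: "path r" "path_image r \<subseteq> ?Q" "pathfinish r = pathstart r"
      unfolding r_def by (auto simp: path_image_join seg simp del: mem_Times_iff intro!: seg[THEN subsetD])
    have "homotopic_loops ?Q r (linepath (0, 0) (0, 0))"
      using r by (intro homotopic_loops_linear seg) (auto simp: path_image_def simp del: linepath_refl)
    then have "homotopic_loops (- {z}) (\<beta> \<circ> r) (\<beta> \<circ> linepath (0, 0) (0, 0))"
      by (rule homotopic_loops_continuous_image[OF _ \<beta>_cont]) (use z(3) in blast)
    then have "winding_number (\<beta> \<circ> r) z = winding_number (\<beta> \<circ> linepath (0, 0) (0, 0)) z"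
      by (rule winding_number_homotopic_loops)
    also have "\<beta> \<circ> linepath (0, 0) (0, 0) = linepath (\<beta> (0, 0)) (\<beta> (0, 0))"
      by (auto simp: linepath_refl)
    also have "winding_number \<dots> z = 0"
      using z(3) by (intro winding_number_trivial) auto
    finally have zero: "winding_number (\<beta> \<circ> r) z = 0" .
    have side_path: "path (\<beta> \<circ> linepath x y)" "z \<notin> path_image (\<beta> \<circ> linepath x y)"
      if "x \<in> ?Q" "y \<in> ?Q" for x y
      using seg[OF that] z(3) by (auto simp: path_image_compose intro!: path_continuous_image continuous_on_subset[OF \<beta>_cont])
    have ends: "pathstart (\<beta> \<circ> linepath x y) = \<beta> x" "pathfinish (\<beta> \<circ> linepath x y) = \<beta> y" for x y
      by (simp_all add: pathstart_compose pathfinish_compose)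
    have "winding_number (\<beta> \<circ> r) z = winding_number (\<beta> \<circ> linepath (0, 0) (1, 0)) z +
        (winding_number (\<beta> \<circ> linepath (1, 0) (1, 1)) z + (winding_number (\<beta> \<circ> linepath (1, 1) (0, 1)) z +
         winding_number (\<beta> \<circ> linepath (0, 1) (0, 0)) z))"
      unfolding r_def path_compose_join
      by (simp add: winding_number_join path_image_join side_path ends)
    also have "\<beta> \<circ> linepath (0, 0) (1, 0) = subpath 0 1 (\<lambda>s. \<beta> (s, 0))"
      by (auto simp: linepath_def subpath_def)
    also have "\<beta> \<circ> linepath (1, 1) (0, 1) = subpath 0 1 (\<lambda>s. \<beta> (1 - s, 1))"
      by (auto simp: linepath_def subpath_def)
    also have "winding_number (\<beta> \<circ> linepath (1, 0) (1, 1)) z = winding_number (reversepath (subpath c d (curve E))) z"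
    proof (rule winding_number_cong)
      fix t :: real assume "0 \<le> t" "t \<le> 1"
      then show "(\<beta> \<circ> linepath (1, 0) (1, 1)) t = reversepath (subpath c d (curve E)) t"
        using right[of t] by (simp add: linepath_def subpath_def reversepath_def algebra_simps)
    qed
    also have "winding_number (\<beta> \<circ> linepath (0, 1) (0, 0)) z = winding_number (reversepath (subpath a b (curve D))) z"
    proof (rule winding_number_cong)
      fix t :: real assume "0 \<le> t" "t \<le> 1"
      then show "(\<beta> \<circ> linepath (0, 1) (0, 0)) t = reversepath (subpath a b (curve D)) t"
        using left[of "1 - t"] by (simp add: linepath_def subpath_def reversepath_def algebra_simps)
    qed
    also have "winding_number (reversepath (subpath c d (curve E))) z = - w (curve E) c d"
      unfolding w_def
      by (rule winding_number_reversepath)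
         (use z(2) transverse_continuous[OF E] in \<open>auto simp: path_def subpath_def path_image_def
            intro!: continuous_on_compose2[OF transverse_continuous[OF E, of UNIV]] continuous_intros\<close>)
    also have "winding_number (reversepath (subpath a b (curve D))) z = - w (curve D) a b"
      unfolding w_def
      by (rule winding_number_reversepath)
         (use z(1) in \<open>auto simp: path_def subpath_def path_image_def
            intro!: continuous_on_compose2[OF transverse_continuous[OF D, of UNIV]] continuous_intros\<close>)
    finally show ?thesis unfolding zero by (simp add: w_def algebra_simps)
  qed
  have "winding_number (curve F) z = w (curve F) t0 t1 + w (curve F) t1 t2 + w (curve F) t2 t3 + w (curve F) t3 (t0 + 1)"
    using period[OF F zF, of t0] split[OF F zF refl] times by simp
  moreover have "winding_number (curve D) z = w (curve D) a b + w (curve D) b (a + 1)"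
    using period[OF D z(1), of a] split[OF D z(1) refl] ab(1,2) by simp
  moreover have "winding_number (curve E) z = w (curve E) c d + w (curve E) d (c + 1)"
    using period[OF E z(2), of c] split[OF E z(2) refl] cd(1,2) by simp
  moreover have "w (\<lambda>s. \<beta> (s, 0)) 0 1 = w (curve E) c d + w (curve D) a b - w (\<lambda>s. \<beta> (1 - s, 1)) 0 1"
    using boundary by (simp add: algebra_simps)
  ultimately show ?thesis unfolding runs by simp
qed

text \<open>
  On a neighbourhood \<open>N\<close> of the crossing, away from the band and in the half-plane of \<open>D\<close>, the curves
  \<open>F\<close> and \<open>D\<close> have the same winding numbers. The segment from the test direction \<open>x\<close> of \<open>D\<close> to the
  test direction \<open>y\<close> of \<open>F\<close> stays in one corner, since its points are combinations of \<open>i u\<close> and \<open>j v\<close> with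
  positive coefficients.
\<close>

lemma contribution_of_D:
  assumes p: "p \<in> crossings D"
  shows "crossing_sign F p * crossing_index F p = crossing_sign D p * crossing_index D p"
proof -
  obtain \<alpha> \<gamma> where pos: "\<alpha> > 0" "\<gamma> > 0" and pF: "p \<in> crossings F"
    and tan: "over_tangent F p = \<alpha> *\<^sub>R over_tangent D p" "under_tangent F p = \<gamma> *\<^sub>R under_tangent D p"
    using crossing_of_D_in_F[OF p] .
  define u v where "u = over_tangent D p" and "v = under_tangent D p"
  note tan = tan[folded u_def v_def]
  have uv: "det2 u v \<noteq> 0"
    using crossing_parameters[OF D p] crossing_tangents[OF D] transverse_det[OF D] unfolding u_def v_def by metis
  have sign: "crossing_sign F p = crossing_sign D p"
    unfolding crossing_sign_def tan using pos by (simp add: det2_simps sgn_mult u_def v_def)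
  define N where "N = {z. n \<bullet> z < k} - \<beta> ` ({0..1} \<times> {0..1})"
  have "open N" unfolding N_def
    by (intro open_Diff open_halfspace_lt compact_imp_closed compact_continuous_image[OF \<beta>_cont] compact_Times) auto
  have "p \<in> range (curve D)" using p by (auto simp: crossings_def)
  then have "p \<in> N" using crossing_not_on_band[OF p] halfD by (auto simp: N_def)
  have wind: "winding_number (curve F) z = winding_number (curve D) z" if "z \<in> N" "z \<notin> range (curve D)" for z
  proof -
    have "z \<notin> {z. n \<bullet> z > k}" using that(1) by (auto simp: N_def)
    then have "winding_number (curve E) z = 0"
      using halfE by (intro winding_number_zero_outside[OF transverse_loop(1)[OF E] convex_halfspace_gt transverse_loop(2)[OF E]])
        (auto simp: transverse_range[OF E])
    moreover have "z \<notin> range (curve E)" using \<open>z \<notin> {z. n \<bullet> z > k}\<close> halfE by blast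
    ultimately show ?thesis using winding_number_band_sum[of z] that by (simp add: N_def)
  qed
  have "crossing_index F p = crossing_index D p"
    unfolding crossing_index_def tan u_def[symmetric] v_def[symmetric]
  proof (intro arg_cong2[where f = "(/)"] refl sum.cong)
    fix i j :: real assume ij: "i \<in> {-1, 1}" "j \<in> {-1, 1}"
    define x y where "x = i *\<^sub>R u + j *\<^sub>R v" and "y = i *\<^sub>R \<alpha> *\<^sub>R u + j *\<^sub>R \<gamma> *\<^sub>R v"
    have det: "det2 w u \<noteq> 0 \<and> det2 w v \<noteq> 0" if w: "w \<in> closed_segment x y" for w
    proof -
      obtain l where l: "0 \<le> l" "l \<le> 1" "w = (1 - l) *\<^sub>R x + l *\<^sub>R y"
        using w by (auto simp: closed_segment_def)
      have "1 - l + l * \<alpha> > 0" "1 - l + l * \<gamma> > 0"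
        using l pos by (cases "l = 0"; simp add: add_nonneg_pos)+
      moreover have "w = (i * (1 - l + l * \<alpha>)) *\<^sub>R u + (j * (1 - l + l * \<gamma>)) *\<^sub>R v"
        unfolding l(3) x_def y_def by (simp add: algebra_simps)
      ultimately show ?thesis using ij uv by (auto simp: det2_simps det2_commute[of v u])
    qed
    have 1: "\<forall>\<^sub>F \<epsilon> in at_right 0. \<forall>w\<in>closed_segment x y. p + \<epsilon> *\<^sub>R w \<notin> range (curve D) \<and>
        Re (winding_number (curve D) (p + \<epsilon> *\<^sub>R w)) = region_index D (region_towards D p x)"
      by (rule corner_index_eq_winding_number[OF D p]) (use det in \<open>auto simp: u_def v_def\<close>)
    have 2: "\<forall>\<^sub>F \<epsilon> in at_right 0. \<forall>w\<in>{y}. p + \<epsilon> *\<^sub>R w \<notin> range (curve F) \<and>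
        Re (winding_number (curve F) (p + \<epsilon> *\<^sub>R w)) = region_index F (region_towards F p y)"
      by (rule corner_index_eq_winding_number[OF F pF]) (use det[of y] pos in \<open>auto simp: tan det2_simps\<close>)
    have "((\<lambda>\<epsilon>. p + \<epsilon> *\<^sub>R y) \<longlongrightarrow> p + 0 *\<^sub>R y) (at_right 0)" by (intro tendsto_intros)
    then have 3: "\<forall>\<^sub>F \<epsilon> in at_right 0. p + \<epsilon> *\<^sub>R y \<in> N"
      using \<open>open N\<close> \<open>p \<in> N\<close> by (intro topological_tendstoD) auto
    have "\<forall>\<^sub>F \<epsilon> in at_right (0::real). region_index F (region_towards F p y) = region_index D (region_towards D p x)"
      using 1 2 3
    proof eventually_elim
      case (elim \<epsilon>)
      have "y \<in> closed_segment x y" by simp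
      with elim show ?case using wind[OF elim(3)] by auto
    qed
    then show "region_index F (region_towards F p (i *\<^sub>R \<alpha> *\<^sub>R u + j *\<^sub>R \<gamma> *\<^sub>R v)) =
        region_index D (region_towards D p (i *\<^sub>R u + j *\<^sub>R v))"
      by (simp add: eventually_const_iff x_def y_def)
  qed
  with sign show ?thesis by simp
qed

lemma SCI_band_sum:
  assumes "finite (crossings F)"
  shows "SCI F = SCI D + SCI E"
proof -
  note swapped = diagram_band.crossing_of_D_in_F[OF swap] diagram_band.contribution_of_D[OF swap]
  have "crossings D \<subseteq> crossings F" using crossing_of_D_in_F by blast
  moreover have "crossings E \<subseteq> crossings F" using swapped(1) by blast
  ultimately have F_eq: "crossings F = crossings D \<union> crossings E" using crossings_band_sum_subset by blast
  have "crossings G \<subseteq> range (curve G)" for G by (auto simp: crossings_def)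
  then have disj: "crossings D \<inter> crossings E = {}" using half_planes_disjoint by blast
  have "SCI F = (\<Sum>p\<in>crossings D. crossing_sign F p * crossing_index F p) +
      (\<Sum>p\<in>crossings E. crossing_sign F p * crossing_index F p)"
    unfolding SCI_def F_eq using assms disj by (intro sum.union_disjoint) (auto simp: F_eq)
  then show ?thesis
    unfolding SCI_def by (simp add: contribution_of_D swapped(2))
qed

end

section \<open>Additivity of SCI\<close>

theorem theorem3p5:
  fixes D E F :: diagram
  assumes "knot_diagram D" and "knot_diagram E" and "connected_sum D E F"
  shows "SCI F = SCI D + SCI E"
proof -
  obtain g h where gh: "plane_diffeo g" "plane_diffeo h" and band: "band_sum (move g D) (move h E) F"
    and F: "knot_diagram F"
    using assms(3) unfolding connected_sum_def by blast
  have D': "transverse_diagram (move g D)" and E': "transverse_diagram (move h E)"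
    using assms(1,2) gh by (auto intro: SCI_move knot_diagram_imp_transverse)
  have "SCI F = SCI (move g D) + SCI (move h E)"
  proof -
    obtain n k where nk: "range (curve (move g D)) \<subseteq> {z. n \<bullet> z < k}" "range (curve (move h E)) \<subseteq> {z. n \<bullet> z > k}"
      using band unfolding band_sum_def by (elim conjE exE)
    obtain \<beta> :: "real \<times> real \<Rightarrow> complex" and a b c d t0 t1 t2 t3 where
      cont: "continuous_on ({0..1} \<times> {0..1}) \<beta>" "inj_on \<beta> ({0..1} \<times> {0..1})" and
      ab: "a < b" "b < a + 1" and D_arc: "\<forall>t\<in>{a..b}. curve (move g D) t \<notin> crossings (move g D)" and
      cd: "c < d" "d < c + 1" and E_arc: "\<forall>t\<in>{c..d}. curve (move h E) t \<notin> crossings (move h E)" and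
      left: "\<forall>t\<in>{0..1}. \<beta> (0, t) = curve (move g D) (a + t * (b - a))" and
      right: "\<forall>t\<in>{0..1}. \<beta> (1, t) = curve (move h E) (d - t * (d - c))" and
      inner: "\<beta> ` ({0<..<1} \<times> {0..1}) \<subseteq> outside (range (curve (move g D)) \<union> range (curve (move h E)))" and
      times: "t0 < t1" "t1 < t2" "t2 < t3" "t3 < t0 + 1" and
      run: "runs_along (strands F) t0 t1 (strands (move g D)) b (a + 1)"
        "runs_along (curve F) t1 t2 (\<lambda>s. \<beta> (s, 0)) 0 1"
        "runs_along (strands F) t2 t3 (strands (move h E)) d (c + 1)"
        "runs_along (curve F) t3 (t0 + 1) (\<lambda>s. \<beta> (1 - s, 1)) 0 1"
      using band unfolding band_sum_def by (elim conjE exE)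
    have "diagram_band (move g D) (move h E) F n k \<beta> a b c d t0 t1 t2 t3"
      by (rule diagram_band.intro)
         (fact D' E' knot_diagram_imp_transverse[OF F] nk cont ab cd inner times run
           D_arc[rule_format] E_arc[rule_format] left[rule_format] right[rule_format])+
    then show ?thesis
      using F by (intro diagram_band.SCI_band_sum) (auto simp: knot_diagram_def)
  qed
  also have "\<dots> = SCI D + SCI E"
    using assms(1,2) gh by (simp add: SCI_move(2) knot_diagram_imp_transverse)
  finally show ?thesis .
qed

end
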